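(* Let $n\geqslant 4$. Let $\rho:WB_n\to GL_n(\mathbb{C})$ be an $n$-dimensional representation of the welded braid group $WB_n$ such that its restriction $\rho|_{B_n}$ to the braid group $B_n$ is equivalent to a specialization $\tau_n(z)$ of the standard representation for some $z\in\mathbb{C}^*$, $z\neq 1$. Then there exists a unique pair $(\lambda,k)$, where $\lambda\in\mathbb{C}^*$ and $k\in\{-1,1\}$, such that $\rho$ is equivalent to $X_n(1,k)\otimes\widetilde{\tau}_n(z,\lambda)$.
   Context: The welded braid group $WB_n$ is the group generated by $\alpha_1,\dots,\alpha_{n-1},\sigma_1,\dots,\sigma_{n-1}$ with defining relations: $\alpha_i^2=1$ ($1\leqslant i\leqslant n-1$); $\alpha_i\alpha_j=\alpha_j\alpha_i$, $\sigma_i\sigma_j=\sigma_j\sigma_i$, $\alpha_i\sigma_j=\sigma_j\alpha_i$ for $|i-j|\geqslant 2$; and, for $1\leqslant i\leqslant n-2$, $\alpha_i\alpha_{i+1}\alpha_i=\alpha_{i+1}\alpha_i\alpha_{i+1}$, $\sigma_i\sigma_{i+1}\sigma_i=\sigma_{i+1}\sigma_i\sigma_{i+1}$, $\alpha_i\alpha_{i+1}\sigma_i=\sigma_{i+1}\alpha_i\alpha_{i+1}$, $\sigma_i\sigma_{i+1}\alpha_i=\alpha_{i+1}\sigma_i\sigma_{i+1}$. The subgroup generated by the $\sigma_i$ is isomorphic to the braid group on $n$ strings and is denoted $B_n$. Matrices act on column vectors. For $y\in\mathbb{C}^*$, $k\in\{-1,1\}$, $X_n(y,k):WB_n\to\mathbb{C}^*$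 is the one-dimensional representation $\sigma_i\mapsto y$, $\alpha_i\mapsto k$ for all $i$. With $I_m$ the $m\times m$ identity and $\oplus$ block-diagonal sum: for $z\in\mathbb{C}^*$ the standard representation $\tau_n(z):B_n\to GL_n(\mathbb{C})$ is $\tau_n(z)(\sigma_i)=I_{i-1}\oplus\begin{pmatrix}0&z\\1&0\end{pmatrix}\oplus I_{n-1-i}$, $1\leqslant i\leqslant n-1$. For $z,\lambda\in\mathbb{C}^*$, $\widetilde{\tau}_n(z,\lambda):WB_n\to GL_n(\mathbb{C})$ is the representation $$\widetilde{\tau}_n(z,\lambda)(\sigma_i)=\tau_n(z)(\sigma_i),\qquad \widetilde{\tau}_n(z,\lambda)(\alpha_i)=I_{i-1}\oplus\begin{pmatrix}0&\frac1\lambda\\ \lambda&0\end{pmatrix}\oplus I_{n-1-i},\qquad 1\leqslant i\leqslant n-1.$$ *)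

theory Defs
  imports
    Complex_Main
    "HOL-Algebra.Generated_Groups"
    "Jordan_Normal_Form.Matrix"
begin

section \<open>Groups given by generators and relations\<close>

text \<open>A letter \<open>(x, True)\<close> stands for the generator \<open>x\<close>, and \<open>(x, False)\<close> for its inverse.\<close>

type_synonym 'a gword = "('a \<times> bool) list"

definition gwords :: "'a set \<Rightarrow> 'a gword set" where
  "gwords S = lists (S \<times> UNIV)"

text \<open>The smallest congruence on the words over \<open>S\<close> which allows free cancellation and identifies
  the two sides of every relation in \<open>R\<close>.\<close>

inductive_set pres_rel :: "'a set \<Rightarrow> ('a gword \<times> 'a gword) set \<Rightarrow> ('a gword \<times> 'a gword) set"
  for S :: "'a set" and R :: "('a gword \<times> 'a gword) set" where
  refl: "w \<in> gwords S \<Longrightarrow> (w, w) \<in> pres_rel S R"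
| sym: "(u, v) \<in> pres_rel S R \<Longrightarrow> (v, u) \<in> pres_rel S R"
| trans: "(u, v) \<in> pres_rel S R \<Longrightarrow> (v, w) \<in> pres_rel S R \<Longrightarrow> (u, w) \<in> pres_rel S R"
| append: "(u, u') \<in> pres_rel S R \<Longrightarrow> (v, v') \<in> pres_rel S R \<Longrightarrow> (u @ v, u' @ v') \<in> pres_rel S R"
| cancel: "x \<in> S \<Longrightarrow> ([(x, b), (x, \<not> b)], []) \<in> pres_rel S R"
| relation: "(u, v) \<in> R \<Longrightarrow> (u, v) \<in> pres_rel S R"

definition presented_group :: "'a set \<Rightarrow> ('a gword \<times> 'a gword) set \<Rightarrow> 'a gword set monoid" where
  "presented_group S R =
     \<lparr> carrier = gwords S // pres_rel S R,
       monoid.mult = (\<lambda>A B. \<Union>u\<in>A. \<Union>v\<in>B. pres_rel S R `` {u @ v}),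
       monoid.one = pres_rel S R `` {[]} \<rparr>"

definition pres_gen :: "'a set \<Rightarrow> ('a gword \<times> 'a gword) set \<Rightarrow> 'a \<Rightarrow> 'a gword set" where
  "pres_gen S R x = pres_rel S R `` {[(x, True)]}"

text \<open>The homomorphism from \<open>G\<close> to \<open>H\<close> with \<open>g i \<mapsto> f i\<close> for \<open>i \<in> I\<close>, for a family \<open>g\<close>
  generating \<open>G\<close>. It is made unique as a function by asking for the value \<open>undefined\<close> outside
  the carrier. Existence is proved below for each use.\<close>

definition hom_on_gens ::
  "('g, 'a) monoid_scheme \<Rightarrow> ('h, 'b) monoid_scheme \<Rightarrow> 'i set \<Rightarrow> ('i \<Rightarrow> 'g) \<Rightarrow> ('i \<Rightarrow> 'h) \<Rightarrow> 'g \<Rightarrow> 'h" where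
  "hom_on_gens G H I g f =
     (THE h. h \<in> hom G H \<and> h \<in> extensional (carrier G) \<and> (\<forall>i\<in>I. h (g i) = f i))"


section \<open>The welded braid group\<close>

datatype wb_letter = Alpha_gen nat | Sigma_gen nat

definition wb_letters :: "nat \<Rightarrow> wb_letter set" where
  "wb_letters n = Alpha_gen ` {1..<n} \<union> Sigma_gen ` {1..<n}"

definition wb_equations :: "nat \<Rightarrow> (wb_letter list \<times> wb_letter list) set" where
  "wb_equations n =
     {([Alpha_gen i, Alpha_gen i], []) |i. 1 \<le> i \<and> i < n}
   \<union> {([Alpha_gen i, Alpha_gen j], [Alpha_gen j, Alpha_gen i]) |i j.
        i \<in> {1..<n} \<and> j \<in> {1..<n} \<and> \<bar>int i - int j\<bar> \<ge> 2}
   \<union> {([Sigma_gen i, Sigma_gen j], [Sigma_gen j, Sigma_gen i]) |i j.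
        i \<in> {1..<n} \<and> j \<in> {1..<n} \<and> \<bar>int i - int j\<bar> \<ge> 2}
   \<union> {([Alpha_gen i, Sigma_gen j], [Sigma_gen j, Alpha_gen i]) |i j.
        i \<in> {1..<n} \<and> j \<in> {1..<n} \<and> \<bar>int i - int j\<bar> \<ge> 2}
   \<union> {([Alpha_gen i, Alpha_gen (i+1), Alpha_gen i], [Alpha_gen (i+1), Alpha_gen i, Alpha_gen (i+1)]) |i. 1 \<le> i \<and> i + 1 < n}
   \<union> {([Sigma_gen i, Sigma_gen (i+1), Sigma_gen i], [Sigma_gen (i+1), Sigma_gen i, Sigma_gen (i+1)]) |i. 1 \<le> i \<and> i + 1 < n}
   \<union> {([Alpha_gen i, Alpha_gen (i+1), Sigma_gen i], [Sigma_gen (i+1), Alpha_gen i, Alpha_gen (i+1)]) |i. 1 \<le> i \<and> i + 1 < n}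
   \<union> {([Sigma_gen i, Sigma_gen (i+1), Alpha_gen i], [Alpha_gen (i+1), Sigma_gen i, Sigma_gen (i+1)]) |i. 1 \<le> i \<and> i + 1 < n}"

definition wb_relations :: "nat \<Rightarrow> (wb_letter gword \<times> wb_letter gword) set" where
  "wb_relations n =
     (\<lambda>(u, v). (map (\<lambda>x. (x, True)) u, map (\<lambda>x. (x, True)) v)) ` wb_equations n"

definition WB :: "nat \<Rightarrow> wb_letter gword set monoid" where
  "WB n = presented_group (wb_letters n) (wb_relations n)"

definition wb_gen :: "nat \<Rightarrow> wb_letter \<Rightarrow> wb_letter gword set" where
  "wb_gen n = pres_gen (wb_letters n) (wb_relations n)"

text \<open>The braid group on \<open>n\<close> strings is taken as the subgroup of the welded braid group which it
  is isomorphic to, not as a separately presented group. \<open>BG n\<close> is this subgroup as a group.\<close>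

definition braid_sub :: "nat \<Rightarrow> wb_letter gword set set" where
  "braid_sub n = generate (WB n) ((\<lambda>i. wb_gen n (Sigma_gen i)) ` {1..<n})"

definition BG :: "nat \<Rightarrow> wb_letter gword set monoid" where
  "BG n = (WB n)\<lparr>carrier := braid_sub n\<rparr>"


section \<open>Representations\<close>

definition GL :: "nat \<Rightarrow> complex mat monoid" where
  "GL n = units_of (ring_mat TYPE(complex) n ())"

definition Cstar :: "complex monoid" where
  "Cstar = \<lparr>carrier = UNIV - {0}, monoid.mult = (*), monoid.one = 1\<rparr>"

definition is_rep :: "('g, 'a) monoid_scheme \<Rightarrow> nat \<Rightarrow> ('g \<Rightarrow> complex mat) \<Rightarrow> bool" where
  "is_rep G n \<rho> \<longleftrightarrow> \<rho> \<in> hom G (GL n)"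

definition equiv_rep ::
  "('g, 'a) monoid_scheme \<Rightarrow> nat \<Rightarrow> ('g \<Rightarrow> complex mat) \<Rightarrow> ('g \<Rightarrow> complex mat) \<Rightarrow> bool" where
  "equiv_rep G n \<rho> \<rho>' \<longleftrightarrow>
     (\<exists>P \<in> carrier (GL n). \<forall>g \<in> carrier G. \<rho>' g = P * \<rho> g * inv\<^bsub>GL n\<^esub> P)"

text \<open>Tensor product of a one-dimensional representation \<open>\<chi>\<close> with a matrix representation, under
  the identification of the tensor product of \<open>\<complex>\<close> and \<open>\<complex>\<^sup>n\<close> with \<open>\<complex>\<^sup>n\<close>.\<close>

definition char_tensor :: "('g \<Rightarrow> complex) \<Rightarrow> ('g \<Rightarrow> complex mat) \<Rightarrow> 'g \<Rightarrow> complex mat" where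
  "char_tensor \<chi> \<rho> = (\<lambda>g. \<chi> g \<cdot>\<^sub>m \<rho> g)"

definition X_rep :: "nat \<Rightarrow> complex \<Rightarrow> complex \<Rightarrow> wb_letter gword set \<Rightarrow> complex" where
  "X_rep n y k = hom_on_gens (WB n) Cstar (wb_letters n) (wb_gen n)
     (\<lambda>x. case x of Alpha_gen i \<Rightarrow> k | Sigma_gen i \<Rightarrow> y)"

definition block_at :: "nat \<Rightarrow> nat \<Rightarrow> complex mat \<Rightarrow> complex mat" where
  "block_at n i A = diag_block_mat [1\<^sub>m (i - 1), A, 1\<^sub>m (n - 1 - i)]"

definition tau_sigma :: "nat \<Rightarrow> complex \<Rightarrow> nat \<Rightarrow> complex mat" where
  "tau_sigma n z i = block_at n i (mat_of_rows_list 2 [[0, z], [1, 0]])"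

definition tau_alpha :: "nat \<Rightarrow> complex \<Rightarrow> nat \<Rightarrow> complex mat" where
  "tau_alpha n lam i = block_at n i (mat_of_rows_list 2 [[0, 1 / lam], [lam, 0]])"

definition tau :: "nat \<Rightarrow> complex \<Rightarrow> wb_letter gword set \<Rightarrow> complex mat" where
  "tau n z = hom_on_gens (BG n) (GL n) {1..<n} (\<lambda>i. wb_gen n (Sigma_gen i)) (tau_sigma n z)"

definition tau_tilde :: "nat \<Rightarrow> complex \<Rightarrow> complex \<Rightarrow> wb_letter gword set \<Rightarrow> complex mat" where
  "tau_tilde n z lam = hom_on_gens (WB n) (GL n) (wb_letters n) (wb_gen n)
     (\<lambda>x. case x of Alpha_gen i \<Rightarrow> tau_alpha n lam i | Sigma_gen i \<Rightarrow> tau_sigma n z i)"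


section \<open>Presented groups are groups and have the universal property\<close>

lemma gwords_append [simp]: "u @ v \<in> gwords S \<longleftrightarrow> u \<in> gwords S \<and> v \<in> gwords S"
  by (auto simp: gwords_def)

lemma gwords_Nil [simp]: "[] \<in> gwords S"
  by (auto simp: gwords_def)

lemma gwords_Cons [simp]: "a # v \<in> gwords S \<longleftrightarrow> fst a \<in> S \<and> v \<in> gwords S"
  by (cases a) (auto simp: gwords_def)

locale presentation =
  fixes S :: "'a set" and R :: "('a gword \<times> 'a gword) set"
  assumes R_sub: "R \<subseteq> gwords S \<times> gwords S"
begin

abbreviation "E \<equiv> pres_rel S R"
abbreviation "G \<equiv> presented_group S R"
abbreviation cl :: "'a gword \<Rightarrow> 'a gword set" where "cl w \<equiv> E `` {w}"

lemma pres_rel_words: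
  assumes "(u, v) \<in> E" shows "u \<in> gwords S \<and> v \<in> gwords S"
  using assms by induction (use R_sub in auto)

lemma equiv_E: "equiv (gwords S) E"
proof (rule equivI)
  show "E \<subseteq> gwords S \<times> gwords S" using pres_rel_words by auto
  show "refl_on (gwords S) E" by (auto simp: refl_on_def intro: pres_rel.refl)
  show "Relation.sym E" by (auto intro!: symI intro: pres_rel.sym)
  show "Relation.trans E" by (blast intro!: transI intro: pres_rel.trans)
qed

lemma cl_eq: "(u, v) \<in> E \<Longrightarrow> cl u = cl v"
  using equiv_class_eq[OF equiv_E] .

lemma cl_self: "w \<in> gwords S \<Longrightarrow> w \<in> cl w"
  by (simp add: pres_rel.refl)

lemma carrierE: 
  assumes "A \<in> carrier G" obtains w where "w \<in> gwords S" "A = cl w"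
  using assms by (auto simp: presented_group_def elim: quotientE)

lemma cl_carrier: "w \<in> gwords S \<Longrightarrow> cl w \<in> carrier G"
  by (simp add: presented_group_def quotientI)

lemma mult_cl:
  assumes "u \<in> gwords S" "v \<in> gwords S" shows "cl u \<otimes>\<^bsub>G\<^esub> cl v = cl (u @ v)"
proof -
  have "cl (u' @ v') = cl (u @ v)" if "u' \<in> cl u" "v' \<in> cl v" for u' v'
    using that by (intro cl_eq pres_rel.append) (auto intro: pres_rel.sym)
  then have "(\<Union>u'\<in>cl u. \<Union>v'\<in>cl v. cl (u' @ v')) = cl (u @ v)"
    using cl_self[OF assms(1)] cl_self[OF assms(2)] by blast
  then show ?thesis by (simp add: presented_group_def)
qed

lemma one_cl: "\<one>\<^bsub>G\<^esub> = cl []"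
  by (simp add: presented_group_def)

definition inv_word :: "'a gword \<Rightarrow> 'a gword" where
  "inv_word w = rev (map (\<lambda>(x, b). (x, \<not> b)) w)"

lemma inv_word_words: "w \<in> gwords S \<Longrightarrow> inv_word w \<in> gwords S"
  by (auto simp: inv_word_def gwords_def)

lemma inv_word_cancel: "w \<in> gwords S \<Longrightarrow> (inv_word w @ w, []) \<in> E"
proof (induction w)
  case Nil
  then show ?case by (simp add: inv_word_def pres_rel.refl)
next
  case (Cons a w)
  obtain x b where a: "a = (x, b)" by (cases a)
  have x: "x \<in> S" and w: "w \<in> gwords S" using Cons.prems a by auto
  have "([(x, \<not> b), (x, b)], []) \<in> E" using pres_rel.cancel[OF x, of "\<not> b"] by simp
  then have "([(x, \<not> b), (x, b)] @ w, [] @ w) \<in> E"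
    by (rule pres_rel.append) (rule pres_rel.refl[OF w])
  then have "(inv_word w @ ([(x, \<not> b), (x, b)] @ w), inv_word w @ ([] @ w)) \<in> E"
    by (rule pres_rel.append[OF pres_rel.refl[OF inv_word_words[OF w]]])
  then have "(inv_word (a # w) @ (a # w), inv_word w @ w) \<in> E"
    by (simp add: inv_word_def a)
  then show ?case using Cons.IH[OF w] pres_rel.trans by blast
qed

lemma group_G: "group G"
proof (rule groupI)
  fix x y assume "x \<in> carrier G" "y \<in> carrier G"
  then show "x \<otimes>\<^bsub>G\<^esub> y \<in> carrier G"
    by (elim carrierE) (simp add: mult_cl cl_carrier)
next
  show "\<one>\<^bsub>G\<^esub> \<in> carrier G" by (simp add: one_cl cl_carrier)
next
  fix x y z assume "x \<in> carrier G" "y \<in> carrier G" "z \<in> carrier G"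
  then show "x \<otimes>\<^bsub>G\<^esub> y \<otimes>\<^bsub>G\<^esub> z = x \<otimes>\<^bsub>G\<^esub> (y \<otimes>\<^bsub>G\<^esub> z)"
    by (elim carrierE) (simp add: mult_cl)
next
  fix x assume "x \<in> carrier G"
  then show "\<one>\<^bsub>G\<^esub> \<otimes>\<^bsub>G\<^esub> x = x"
    by (elim carrierE) (simp add: mult_cl one_cl)
next
  fix x assume "x \<in> carrier G"
  then obtain w where w: "w \<in> gwords S" "x = cl w" by (elim carrierE)
  have "cl (inv_word w) \<otimes>\<^bsub>G\<^esub> x = \<one>\<^bsub>G\<^esub>"
    using w inv_word_words[OF w(1)] cl_eq[OF inv_word_cancel[OF w(1)]]
    by (simp add: mult_cl one_cl)
  then show "\<exists>y\<in>carrier G. y \<otimes>\<^bsub>G\<^esub> x = \<one>\<^bsub>G\<^esub>"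
    using w cl_carrier inv_word_words by blast
qed

lemma gen_carrier: "x \<in> S \<Longrightarrow> pres_gen S R x \<in> carrier G"
  unfolding pres_gen_def by (rule cl_carrier) simp

lemma inv_gen: 
  assumes "x \<in> S" shows "inv\<^bsub>G\<^esub> pres_gen S R x = cl [(x, False)]"
proof -
  have "cl [(x, False)] \<otimes>\<^bsub>G\<^esub> pres_gen S R x = \<one>\<^bsub>G\<^esub>"
    using assms cl_eq[OF pres_rel.cancel[OF assms, of False]]
    by (simp add: pres_gen_def mult_cl one_cl)
  then show ?thesis
    using assms group.inv_equality[OF group_G _ gen_carrier cl_carrier] by simp
qed

lemma generate_gens: "generate G (pres_gen S R ` S) = carrier G"
proof
  show "generate G (pres_gen S R ` S) \<subseteq> carrier G"
    using group.generate_incl[OF group_G] gen_carrier by blast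
  have "cl w \<in> generate G (pres_gen S R ` S)" if "w \<in> gwords S" for w
    using that
  proof (induction w)
    case Nil
    then show ?case using generate.one[of G] by (simp add: one_cl)
  next
    case (Cons a w)
    obtain x b where a: "a = (x, b)" by (cases a)
    have x: "x \<in> S" and w: "w \<in> gwords S" using Cons.prems a by auto
    have "cl [(x, b)] \<in> generate G (pres_gen S R ` S)"
    proof (cases b)
      case True
      then have "cl [(x, b)] = pres_gen S R x" by (simp add: pres_gen_def)
      then show ?thesis using x by (simp add: generate.incl)
    next
      case False
      then have "cl [(x, b)] = inv\<^bsub>G\<^esub> pres_gen S R x" using inv_gen[OF x] by simp
      then show ?thesis using x generate.inv[of "pres_gen S R x" "pres_gen S R ` S" G] by simp
    qed
    then have "cl [(x, b)] \<otimes>\<^bsub>G\<^esub> cl w \<in> generate G (pres_gen S R ` S)"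
      using Cons.IH[OF w] by (rule generate.eng)
    then show ?case using x w a by (simp add: mult_cl)
  qed
  then show "carrier G \<subseteq> generate G (pres_gen S R ` S)" by (auto elim: carrierE)
qed

end

fun word_eval :: "('h, 'b) monoid_scheme \<Rightarrow> ('a \<Rightarrow> 'h) \<Rightarrow> 'a gword \<Rightarrow> 'h" where
  "word_eval H f [] = \<one>\<^bsub>H\<^esub>"
| "word_eval H f ((x, b) # w) = (if b then f x else inv\<^bsub>H\<^esub> f x) \<otimes>\<^bsub>H\<^esub> word_eval H f w"

lemma (in presentation) presented_group_lift:
  assumes H: "group H" and f: "\<And>x. x \<in> S \<Longrightarrow> f x \<in> carrier H"
    and rel: "\<And>u v. (u, v) \<in> R \<Longrightarrow> word_eval H f u = word_eval H f v"
  shows "\<exists>h \<in> hom G H. \<forall>x\<in>S. h (pres_gen S R x) = f x"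
proof -
  interpret H: group H by fact
  have closed: "word_eval H f w \<in> carrier H" if "w \<in> gwords S" for w
    using that
  proof (induction w)
    case (Cons a w)
    then show ?case by (cases a) (auto simp: f)
  qed auto
  have app: "word_eval H f (u @ v) = word_eval H f u \<otimes>\<^bsub>H\<^esub> word_eval H f v"
    if "u \<in> gwords S" "v \<in> gwords S" for u v
    using that
  proof (induction u)
    case (Cons a u)
    then show ?case by (cases a) (auto simp: f closed H.m_assoc)
  qed (auto simp: closed)
  have wd: "word_eval H f u = word_eval H f v" if "(u, v) \<in> E" for u v
    using that
  proof induction
    case (append u u' v v')
    then show ?case using pres_rel_words app by metis
  next
    case (cancel x b)
    then show ?case by (auto simp: f)
  qed (auto simp: rel)
  define h where "h = (\<lambda>A. the_elem (word_eval H f ` A))"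
  have h_cl: "h (cl w) = word_eval H f w" if "w \<in> gwords S" for w
  proof -
    have "word_eval H f ` cl w = (\<lambda>_. word_eval H f w) ` cl w"
      by (rule image_cong[OF HOL.refl]) (auto dest: wd)
    also have "\<dots> = {word_eval H f w}"
      using cl_self[OF that] by (rule image_constant)
    finally have "word_eval H f ` cl w = {word_eval H f w}" .
    then show ?thesis by (simp add: h_def)
  qed
  have "h \<in> hom G H"
    by (rule homI) (auto elim!: carrierE simp: h_cl closed mult_cl app)
  moreover have "h (pres_gen S R x) = f x" if "x \<in> S" for x
    using that h_cl[of "[(x, True)]"] by (simp add: pres_gen_def f)
  ultimately show ?thesis by blast
qed

lemma hom_eq_on_generate:
  assumes G: "group G" and H: "group H" and g: "g ` I \<subseteq> carrier G"
    and h: "h \<in> hom (G\<lparr>carrier := generate G (g ` I)\<rparr>) H"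
    and h': "h' \<in> hom (G\<lparr>carrier := generate G (g ` I)\<rparr>) H"
    and eq: "\<And>i. i \<in> I \<Longrightarrow> h (g i) = h' (g i)"
    and x: "x \<in> generate G (g ` I)"
  shows "h x = h' x"
proof -
  let ?K = "G\<lparr>carrier := generate G (g ` I)\<rparr>"
  have sub: "subgroup (generate G (g ` I)) G"
    using group.generate_is_subgroup[OF G g] .
  have K: "group ?K" using subgroup.subgroup_is_group[OF sub G] .
  interpret h: group_hom ?K H h using K H h by (simp add: group_hom_def group_hom_axioms_def)
  interpret h': group_hom ?K H h' using K H h' by (simp add: group_hom_def group_hom_axioms_def)
  show ?thesis using x
  proof (induction rule: generate.induct)
    case one
    then show ?case using h.hom_one h'.hom_one by simp
  next
    case (incl y)
    then show ?case using eq by auto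
  next
    case (inv y)
    have y: "y \<in> carrier ?K" using inv by (simp add: generate.incl)
    have "inv\<^bsub>?K\<^esub> y = inv\<^bsub>G\<^esub> y"
      using group.m_inv_consistent[OF G sub] y by simp
    then show ?case using h.hom_inv[OF y] h'.hom_inv[OF y] eq inv by auto
  next
    case (eng y1 y2)
    then show ?case using h.hom_mult[of y1 y2] h'.hom_mult[of y1 y2] by simp
  qed
qed

lemma hom_on_gens_unique:
  fixes G (structure)
  assumes G: "group G" and H: "group H" and g: "g ` I \<subseteq> carrier G"
    and ex: "\<exists>h \<in> hom (G\<lparr>carrier := generate G (g ` I)\<rparr>) H. \<forall>i\<in>I. h (g i) = f i"
  defines "K \<equiv> G\<lparr>carrier := generate G (g ` I)\<rparr>"
  shows "hom_on_gens K H I g f \<in> hom K H"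
    and "hom_on_gens K H I g f \<in> extensional (carrier K)"
    and "i \<in> I \<Longrightarrow> hom_on_gens K H I g f (g i) = f i"
proof -
  let ?P = "\<lambda>h. h \<in> hom K H \<and> h \<in> extensional (carrier K) \<and> (\<forall>i\<in>I. h (g i) = f i)"
  obtain h where h: "h \<in> hom K H" "\<forall>i\<in>I. h (g i) = f i" using ex unfolding K_def by blast
  have gK: "g i \<in> carrier K" if "i \<in> I" for i using that by (simp add: K_def generate.incl)
  have mon: "x \<otimes>\<^bsub>K\<^esub> y \<in> carrier K" if "x \<in> carrier K" "y \<in> carrier K" for x y
    using that by (auto simp: K_def intro: generate.eng)
  have P: "?P (restrict h (carrier K))"
    using h gK mon by (auto simp: hom_def)
  have uniq: "h1 = h2" if "?P h1" "?P h2" for h1 h2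
  proof (rule extensionalityI)
    show "h1 \<in> extensional (carrier K)" "h2 \<in> extensional (carrier K)" using that by auto
    fix x assume "x \<in> carrier K"
    then show "h1 x = h2 x"
      using hom_eq_on_generate[OF G H g, of h1 h2 x] that by (auto simp: K_def)
  qed
  have "?P (hom_on_gens K H I g f)"
    unfolding hom_on_gens_def by (rule theI[of ?P, OF P]) (rule uniq[OF _ P])
  then show "hom_on_gens K H I g f \<in> hom K H"
    and "hom_on_gens K H I g f \<in> extensional (carrier K)"
    and "i \<in> I \<Longrightarrow> hom_on_gens K H I g f (g i) = f i" by auto
qed


section \<open>Well-definedness of the representations\<close>

interpretation WB: presentation "wb_letters n" "wb_relations n" for n
  by unfold_locales (auto simp: wb_relations_def wb_equations_def wb_letters_def)

lemma group_WB: "group (WB n)"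
  unfolding WB_def by (rule WB.group_G)

lemma wb_gen_carrier: "x \<in> wb_letters n \<Longrightarrow> wb_gen n x \<in> carrier (WB n)"
  unfolding WB_def wb_gen_def by (rule WB.gen_carrier)

lemma generate_WB: "generate (WB n) (wb_gen n ` wb_letters n) = carrier (WB n)"
  unfolding WB_def wb_gen_def by (rule WB.generate_gens)

lemma sigma_carrier: "(\<lambda>i. wb_gen n (Sigma_gen i)) ` {1..<n} \<subseteq> carrier (WB n)"
  using wb_gen_carrier by (auto simp: wb_letters_def)

lemma subgroup_braid_sub: "subgroup (braid_sub n) (WB n)"
  unfolding braid_sub_def by (rule group.generate_is_subgroup[OF group_WB sigma_carrier])

lemma group_BG: "group (BG n)"
  unfolding BG_def by (rule subgroup.subgroup_is_group[OF subgroup_braid_sub group_WB])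

lemma group_GL: "group (GL n)"
proof -
  interpret semiring "ring_mat TYPE(complex) n ()" by (rule semiring_mat)
  show ?thesis unfolding GL_def by (rule units_group)
qed

lemma GL_simps:
  "A \<otimes>\<^bsub>GL n\<^esub> B = A * B" "\<one>\<^bsub>GL n\<^esub> = 1\<^sub>m n"
  "carrier (GL n) = {A \<in> carrier_mat n n. \<exists>B \<in> carrier_mat n n. B * A = 1\<^sub>m n \<and> A * B = 1\<^sub>m n}"
  by (auto simp: GL_def units_of_def ring_mat_simps Units_def)

lemma group_Cstar: "group Cstar"
proof (rule groupI)
  fix x assume "x \<in> carrier Cstar"
  then show "\<exists>y\<in>carrier Cstar. y \<otimes>\<^bsub>Cstar\<^esub> x = \<one>\<^bsub>Cstar\<^esub>"
    by (intro bexI[of _ "inverse x"]) (auto simp: Cstar_def)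
qed (auto simp: Cstar_def)

lemma WB_hom_on_gens:
  assumes H: "group H" and f: "\<And>x. x \<in> wb_letters n \<Longrightarrow> f x \<in> carrier H"
    and rel: "\<And>u v. (u, v) \<in> wb_equations n \<Longrightarrow>
      word_eval H f (map (\<lambda>x. (x, True)) u) = word_eval H f (map (\<lambda>x. (x, True)) v)"
  defines "h \<equiv> hom_on_gens (WB n) H (wb_letters n) (wb_gen n) f"
  shows "h \<in> hom (WB n) H" and "x \<in> wb_letters n \<Longrightarrow> h (wb_gen n x) = f x"
proof -
  have "\<exists>h \<in> hom (WB n) H. \<forall>x\<in>wb_letters n. h (wb_gen n x) = f x"
    unfolding WB_def wb_gen_def
    by (rule WB.presented_group_lift[OF H f]) (use rel in \<open>auto simp: wb_relations_def\<close>)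
  then have ex: "\<exists>h \<in> hom ((WB n)\<lparr>carrier := generate (WB n) (wb_gen n ` wb_letters n)\<rparr>) H.
      \<forall>x\<in>wb_letters n. h (wb_gen n x) = f x"
    by (simp add: generate_WB)
  have "wb_gen n ` wb_letters n \<subseteq> carrier (WB n)" using wb_gen_carrier by blast
  note * = hom_on_gens_unique[OF group_WB H this ex]
  show "h \<in> hom (WB n) H" and "x \<in> wb_letters n \<Longrightarrow> h (wb_gen n x) = f x"
    using * by (simp_all add: generate_WB h_def)
qed

lemma Cstar_simps [simp]:
  "carrier Cstar = UNIV - {0}" "x \<otimes>\<^bsub>Cstar\<^esub> y = x * y" "\<one>\<^bsub>Cstar\<^esub> = 1"
  by (simp_all add: Cstar_def)

lemma X_rep_props:
  assumes "y \<noteq> 0" "k \<in> {-1, 1}"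
  shows X_rep_hom: "X_rep n y k \<in> hom (WB n) Cstar"
    and X_rep_Sigma: "i \<in> {1..<n} \<Longrightarrow> X_rep n y k (wb_gen n (Sigma_gen i)) = y"
    and X_rep_Alpha: "i \<in> {1..<n} \<Longrightarrow> X_rep n y k (wb_gen n (Alpha_gen i)) = k"
proof -
  let ?f = "\<lambda>x. case x of Alpha_gen i \<Rightarrow> k | Sigma_gen i \<Rightarrow> y"
  have f: "?f x \<in> carrier Cstar" for x using assms by (auto split: wb_letter.split)
  have rel: "word_eval Cstar ?f (map (\<lambda>x. (x, True)) u) = word_eval Cstar ?f (map (\<lambda>x. (x, True)) v)"
    if "(u, v) \<in> wb_equations n" for u v
    using that assms unfolding wb_equations_def
    by (elim UnE CollectE exE conjE) (auto simp: mult_ac)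
  show "X_rep n y k \<in> hom (WB n) Cstar"
    unfolding X_rep_def by (rule WB_hom_on_gens(1)[OF group_Cstar], rule f, erule rel)
  have gen: "X_rep n y k (wb_gen n x) = ?f x" if "x \<in> wb_letters n" for x
    unfolding X_rep_def by (rule WB_hom_on_gens(2)[OF group_Cstar], rule f, erule rel, rule that)
  show "i \<in> {1..<n} \<Longrightarrow> X_rep n y k (wb_gen n (Sigma_gen i)) = y"
    and "i \<in> {1..<n} \<Longrightarrow> X_rep n y k (wb_gen n (Alpha_gen i)) = k"
    using gen[of "Sigma_gen i"] gen[of "Alpha_gen i"] by (auto simp: wb_letters_def)
qed

text \<open>Monomial matrices: column \<open>c\<close> has the single entry \<open>d c\<close>, in row \<open>p c\<close>.\<close>

definition mono_mat :: "nat \<Rightarrow> (nat \<Rightarrow> nat) \<Rightarrow> (nat \<Rightarrow> complex) \<Rightarrow> complex mat" where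
  "mono_mat n p d = mat n n (\<lambda>(r, c). if r = p c then d c else 0)"

lemma mono_mat_mult:
  assumes "\<And>c. c < n \<Longrightarrow> p' c < n"
  shows "mono_mat n p d * mono_mat n p' d' = mono_mat n (\<lambda>c. p (p' c)) (\<lambda>c. d (p' c) * d' c)"
proof (rule eq_matI, goal_cases)
  case (1 r c)
  then have rc: "r < n" "c < n" by (auto simp: mono_mat_def)
  have "(mono_mat n p d * mono_mat n p' d') $$ (r, c) =
      (\<Sum>k<n. (if r = p k then d k else 0) * (if k = p' c then d' c else 0))"
    using rc by (simp add: mono_mat_def scalar_prod_def lessThan_atLeast0)
  also have "\<dots> = (\<Sum>k<n. if k = p' c then (if r = p k then d k else 0) * d' c else 0)"
    by (intro sum.cong) auto
  also have "\<dots> = (if r = p (p' c) then d (p' c) else 0) * d' c"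
    using assms[OF rc(2)] by (simp add: sum.delta)
  finally show ?case using rc by (simp add: mono_mat_def)
qed (auto simp: mono_mat_def)

lemma mono_mat_eqI:
  assumes "\<And>c. c < n \<Longrightarrow> p c = p' c \<and> d c = d' c" shows "mono_mat n p d = mono_mat n p' d'"
  using assms by (auto simp: mono_mat_def intro!: eq_matI)

definition sw :: "nat \<Rightarrow> nat \<Rightarrow> nat" where
  "sw i c = (if Suc c = i then i else if c = i then i - 1 else c)"

definition swd :: "complex \<Rightarrow> complex \<Rightarrow> nat \<Rightarrow> nat \<Rightarrow> complex" where
  "swd a b i c = (if Suc c = i then b else if c = i then a else 1)"

lemma block_at_mono:
  assumes "1 \<le> i" "i < n"
  shows "block_at n i (mat_of_rows_list 2 [[0, a], [b, 0]]) = mono_mat n (sw i) (swd a b i)"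
proof -
  obtain j where i: "i = Suc j" using assms by (cases i) auto
  have n: "n = j + (2 + (n - Suc i))" using assms i by auto
  show ?thesis
  proof (rule eq_matI, goal_cases)
    case (1 r c)
    then have rc: "r < n" "c < n" by (auto simp: mono_mat_def)
    show ?case
      using rc assms
      by (auto simp: i block_at_def mono_mat_def sw_def swd_def Let_def mat_of_rows_list_def
          nth_Cons' split: if_splits)
  qed (use n i in \<open>auto simp: block_at_def mono_mat_def Let_def mat_of_rows_list_def\<close>)
qed

lemma sw_less: "i < n \<Longrightarrow> c < n \<Longrightarrow> sw i c < n"
  by (auto simp: sw_def)

lemma tau_sigma_mono: "1 \<le> i \<Longrightarrow> i < n \<Longrightarrow> tau_sigma n z i = mono_mat n (sw i) (swd z 1 i)"
  unfolding tau_sigma_def by (rule block_at_mono)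

lemma tau_alpha_mono: "1 \<le> i \<Longrightarrow> i < n \<Longrightarrow> tau_alpha n l i = mono_mat n (sw i) (swd (1 / l) l i)"
  unfolding tau_alpha_def by (rule block_at_mono)

lemma one_mono: "1\<^sub>m n = mono_mat n (\<lambda>c. c) (\<lambda>c. 1)"
  by (auto simp: mono_mat_def intro!: eq_matI)

lemma sw_GL:
  assumes "1 \<le> i" "i < n" "a \<noteq> 0" "b \<noteq> 0"
  shows "mono_mat n (sw i) (swd a b i) \<in> carrier (GL n)"
proof -
  let ?A = "mono_mat n (sw i) (swd a b i)" and ?B = "mono_mat n (sw i) (swd (1/b) (1/a) i)"
  have "?A * ?B = 1\<^sub>m n" "?B * ?A = 1\<^sub>m n"
    using assms by (auto simp: mono_mat_mult sw_less one_mono intro!: mono_mat_eqI)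
      (use assms in \<open>auto simp: sw_def swd_def\<close>)
  moreover have "?A \<in> carrier_mat n n" "?B \<in> carrier_mat n n" by (auto simp: mono_mat_def)
  ultimately show ?thesis by (auto simp: GL_simps)
qed

lemma sw_commute:
  assumes "1 \<le> i" "1 \<le> j" "i < n" "j < n" "\<bar>int i - int j\<bar> \<ge> 2"
  shows "mono_mat n (sw i) (swd a b i) * mono_mat n (sw j) (swd a' b' j) =
    mono_mat n (sw j) (swd a' b' j) * mono_mat n (sw i) (swd a b i)"
proof -
  have ne: "j \<noteq> i" "j \<noteq> Suc i" "i \<noteq> Suc j" using assms by auto
  have "sw i (sw j c) = sw j (sw i c) \<and>
    swd a b i (sw j c) * swd a' b' j c = swd a' b' j (sw i c) * swd a b i c" for c
  proof -
    consider "Suc c = i" | "c = i" | "Suc c = j" | "c = j"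
      | "Suc c \<noteq> i" "c \<noteq> i" "Suc c \<noteq> j" "c \<noteq> j" by blast
    then show ?thesis
      using ne assms(1,2) by cases (auto simp: sw_def swd_def)
  qed
  note eq = this
  show ?thesis
    using assms by (simp add: mono_mat_mult sw_less) (rule mono_mat_eqI, rule eq)
qed

lemma sw_braid:
  assumes "1 \<le> i" "Suc i < n"
  shows "mono_mat n (sw i) (swd a b i) * (mono_mat n (sw (Suc i)) (swd a b (Suc i)) * mono_mat n (sw i) (swd a' b' i)) =
    mono_mat n (sw (Suc i)) (swd a' b' (Suc i)) * (mono_mat n (sw i) (swd a b i) * mono_mat n (sw (Suc i)) (swd a b (Suc i)))"
proof -
  obtain j where j: "i = Suc j" using assms by (cases i) auto
  have "sw i (sw (Suc i) (sw i c)) = sw (Suc i) (sw i (sw (Suc i) c)) \<and>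
    swd a b i (sw (Suc i) (sw i c)) * (swd a b (Suc i) (sw i c) * swd a' b' i c) =
    swd a' b' (Suc i) (sw i (sw (Suc i) c)) * (swd a b i (sw (Suc i) c) * swd a b (Suc i) c)" for c
  proof -
    consider "c = j" | "c = Suc j" | "c = Suc (Suc j)"
      | "c \<noteq> j" "c \<noteq> Suc j" "c \<noteq> Suc (Suc j)" by blast
    then show ?thesis by cases (simp_all add: j sw_def swd_def)
  qed
  note eq = this
  show ?thesis
    using assms by (simp add: mono_mat_mult sw_less) (rule mono_mat_eqI, rule eq)
qed

lemma sw_square:
  assumes "1 \<le> i" "i < n" "a * b = 1"
  shows "mono_mat n (sw i) (swd a b i) * mono_mat n (sw i) (swd a b i) = 1\<^sub>m n"
  using assms by (auto simp: mono_mat_mult sw_less one_mono intro!: mono_mat_eqI)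
    (auto simp: sw_def swd_def mult.commute)

lemma mono_mat_carrier [simp]: "mono_mat n p d \<in> carrier_mat n n"
  by (simp add: mono_mat_def)

lemma tau_tilde_props:
  assumes "z \<noteq> 0" "l \<noteq> 0"
  shows tau_tilde_rep: "is_rep (WB n) n (tau_tilde n z l)"
    and tau_tilde_Sigma: "i \<in> {1..<n} \<Longrightarrow> tau_tilde n z l (wb_gen n (Sigma_gen i)) = tau_sigma n z i"
    and tau_tilde_Alpha: "i \<in> {1..<n} \<Longrightarrow> tau_tilde n z l (wb_gen n (Alpha_gen i)) = tau_alpha n l i"
proof -
  let ?f = "\<lambda>x. case x of Alpha_gen i \<Rightarrow> tau_alpha n l i | Sigma_gen i \<Rightarrow> tau_sigma n z i"
  have f: "?f x \<in> carrier (GL n)" if "x \<in> wb_letters n" for x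
    using that assms by (auto simp: wb_letters_def tau_sigma_mono tau_alpha_mono intro!: sw_GL)
  have rel: "word_eval (GL n) ?f (map (\<lambda>x. (x, True)) u) = word_eval (GL n) ?f (map (\<lambda>x. (x, True)) v)"
    if "(u, v) \<in> wb_equations n" for u v
  proof -
    have r: "A * 1\<^sub>m n = A" if "A \<in> carrier_mat n n" for A :: "complex mat"
      using that by simp
    show ?thesis
      using that assms unfolding wb_equations_def
      by (elim UnE CollectE exE conjE)
        (simp_all add: GL_simps tau_sigma_mono tau_alpha_mono r sw_commute sw_braid sw_square)
  qed
  show "is_rep (WB n) n (tau_tilde n z l)"
    unfolding is_rep_def tau_tilde_def by (rule WB_hom_on_gens(1)[OF group_GL], erule f, erule rel)
  have gen: "tau_tilde n z l (wb_gen n x) = ?f x" if "x \<in> wb_letters n" for x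
    unfolding tau_tilde_def by (rule WB_hom_on_gens(2)[OF group_GL], erule f, erule rel, rule that)
  show "i \<in> {1..<n} \<Longrightarrow> tau_tilde n z l (wb_gen n (Sigma_gen i)) = tau_sigma n z i"
    and "i \<in> {1..<n} \<Longrightarrow> tau_tilde n z l (wb_gen n (Alpha_gen i)) = tau_alpha n l i"
    using gen[of "Sigma_gen i"] gen[of "Alpha_gen i"] by (auto simp: wb_letters_def)
qed

lemma tau_props:
  assumes "z \<noteq> 0"
  shows tau_rep: "is_rep (BG n) n (tau n z)"
    and tau_Sigma: "i \<in> {1..<n} \<Longrightarrow> tau n z (wb_gen n (Sigma_gen i)) = tau_sigma n z i"
proof -
  have "tau_tilde n z 1 \<in> hom (BG n) (GL n)"
    using tau_tilde_rep[OF assms, of 1 n] subgroup.subset[OF subgroup_braid_sub, of n]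
    by (auto simp: is_rep_def hom_def BG_def Pi_def subset_iff)
  then have ex: "\<exists>h \<in> hom ((WB n)\<lparr>carrier :=
      generate (WB n) ((\<lambda>i. wb_gen n (Sigma_gen i)) ` {1..<n})\<rparr>) (GL n).
      \<forall>i\<in>{1..<n}. h (wb_gen n (Sigma_gen i)) = tau_sigma n z i"
    using tau_tilde_Sigma[OF assms, of 1 _ n]
    by (intro bexI[of _ "tau_tilde n z 1"]) (auto simp: BG_def braid_sub_def)
  note * = hom_on_gens_unique[OF group_WB group_GL sigma_carrier ex,
      folded braid_sub_def, folded BG_def, folded tau_def]
  show "is_rep (BG n) n (tau n z)" unfolding is_rep_def by (rule *)
  show "i \<in> {1..<n} \<Longrightarrow> tau n z (wb_gen n (Sigma_gen i)) = tau_sigma n z i" by (rule *)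
qed

end

theory Submission
  imports Defs
begin

text \<open>
  Conjugate \<open>\<rho>\<close> so that every \<open>\<sigma>\<^sub>i\<close> acts by the matrix \<open>S\<^sub>i\<close> of the standard
  representation, and write \<open>A\<^sub>i\<close> for the image of \<open>\<alpha>\<^sub>i\<close>. The relation
  \<open>\<sigma>\<^sub>i \<sigma>\<^sub>i\<^sub>+\<^sub>1 \<alpha>\<^sub>i = \<alpha>\<^sub>i\<^sub>+\<^sub>1 \<sigma>\<^sub>i \<sigma>\<^sub>i\<^sub>+\<^sub>1\<close> makes each \<open>A\<^sub>i\<^sub>+\<^sub>1\<close> a known
  conjugate of \<open>A\<^sub>i\<close>, so everything is determined by \<open>A\<^sub>1\<close>.

  Since \<open>z \<noteq> 1\<close>, the matrix \<open>S\<^sub>i\<close> has no fixed vector in the plane that it moves. Hence a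
  matrix commuting with \<open>S\<^sub>i\<close> respects the splitting into this plane and the remaining
  coordinates (\<open>commuting_row\<close>, \<open>commuting_col\<close>). As \<open>A\<^sub>1\<close> commutes with
  \<open>S\<^sub>3, \<dots>, S\<^sub>n\<^sub>-\<^sub>1\<close>, it is the sum of a block with rows \<open>(a, b)\<close> and \<open>(c, d)\<close> on the
  first two coordinates and a block on the others, which is a scalar \<open>p\<close> except that for
  \<open>n = 4\<close> it may be \<open>p + q S\<^sub>3\<close>. Both cases are treated together, with \<open>q\<close> denoting an
  entry of \<open>A\<^sub>1\<close>. The relations between \<open>A\<^sub>1\<close>, \<open>A\<^sub>2\<close>, \<open>S\<^sub>1\<close> and \<open>S\<^sub>2\<close>, read off
  at a few entries, become polynomial equations in \<open>a, b, c, d, p, q, z\<close>; their only solutions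
  with \<open>z \<noteq> 0, 1\<close> have \<open>q = a = d = 0\<close>, \<open>p = \<plusminus>1\<close> and \<open>b c = 1\<close> (\<open>block_equations\<close>).
  This says \<open>A\<^sub>1 = k \<cdot> \<tau>(\<alpha>\<^sub>1)\<close> with \<open>k = p\<close> and \<open>\<lambda> = p c\<close>, and existence follows
  (\<open>standard_extension\<close>).

  For uniqueness, an intertwiner of two such representations commutes with all \<open>S\<^sub>i\<close>, so it is
  a scalar (\<open>commutant_scalar\<close>). The two representations then coincide, and the entries of
  the image of \<open>\<alpha>\<^sub>1\<close> give back \<open>k\<close> and \<open>k \<lambda>\<close>.

  Generators are numbered from 1 but matrix indices start at 0, so the \<open>i\<close>-th generators act on
  the coordinates \<open>i - 1\<close> and \<open>i\<close>.
\<close>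

section \<open>Entries of products with the braid generators\<close>

lemma mult_entry:
  assumes "A \<in> carrier_mat n n" "B \<in> carrier_mat n n" "r < n" "c < n"
  shows "(A * B) $$ (r, c) = (\<Sum>k<n. A $$ (r, k) * B $$ (k, c))"
  using assms by (simp add: scalar_prod_def lessThan_atLeast0)

text \<open>The matrices below are sparse in the rows that matter, for every \<open>n\<close>; this replaces sums of
  unspecified length by two explicit terms.\<close>

lemma mult_entry_two:
  assumes "A \<in> carrier_mat n n" "B \<in> carrier_mat n n" "r < n" "c < n"
    and "x < n" "y < n" "x \<noteq> y" and "\<And>k. k < n \<Longrightarrow> k \<noteq> x \<Longrightarrow> k \<noteq> y \<Longrightarrow> A $$ (r, k) = 0"
  shows "(A * B) $$ (r, c) = A $$ (r, x) * B $$ (x, c) + A $$ (r, y) * B $$ (y, c)"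
proof -
  have "(A * B) $$ (r, c) = (\<Sum>k\<in>{x, y}. A $$ (r, k) * B $$ (k, c))"
    unfolding mult_entry[OF assms(1-4)]
    by (rule sum.mono_neutral_right) (use assms in auto)
  then show ?thesis using \<open>x \<noteq> y\<close> by simp
qed

lemma mult_mono_mat_entry:
  assumes "A \<in> carrier_mat n n" "r < n" "c < n" "p c < n"
  shows "(A * mono_mat n p d) $$ (r, c) = A $$ (r, p c) * d c"
proof -
  have "(A * mono_mat n p d) $$ (r, c) = (\<Sum>k<n. if k = p c then A $$ (r, k) * d c else 0)"
    unfolding mult_entry[OF assms(1) mono_mat_carrier assms(2,3)]
    by (intro sum.cong) (use assms in \<open>auto simp: mono_mat_def\<close>)
  then show ?thesis using assms by simp
qed

lemma sw_invol: "1 \<le> i \<Longrightarrow> sw i (sw i c) = c"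
  by (auto simp: sw_def)

lemma sw_mult_entry:
  assumes "A \<in> carrier_mat n n" "r < n" "c < n" "1 \<le> i" "i < n"
  shows "(mono_mat n (sw i) d * A) $$ (r, c) = d (sw i r) * A $$ (sw i r, c)"
proof -
  have *: "r = sw i k \<longleftrightarrow> k = sw i r" for k
    using sw_invol[OF assms(4)] by metis
  have "(mono_mat n (sw i) d * A) $$ (r, c) =
      (\<Sum>k<n. if k = sw i r then d k * A $$ (k, c) else 0)"
    unfolding mult_entry[OF mono_mat_carrier assms(1-3)]
    by (intro sum.cong) (use assms in \<open>auto simp: mono_mat_def *\<close>)
  then show ?thesis using assms sw_less[of i n r] by simp
qed

abbreviation braid_mat :: "nat \<Rightarrow> complex \<Rightarrow> nat \<Rightarrow> complex mat" where
  "braid_mat n z i \<equiv> mono_mat n (sw i) (swd z 1 i)"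

section \<open>Matrices commuting with braid generators\<close>

text \<open>Comparing the entries of \<open>A S\<^sub>i\<close> and \<open>S\<^sub>i A\<close> at a position with only one index in
  \<open>{i - 1, i}\<close> gives \<open>x = y\<close> and \<open>x = z y\<close> for the two entries of \<open>A\<close> involved, so both
  vanish as \<open>z \<noteq> 1\<close>.\<close>

lemma commuting_entries:
  assumes A: "A \<in> carrier_mat n n" and i: "1 \<le> i" "i < n" and "z \<noteq> 1"
    and comm: "A * braid_mat n z i = braid_mat n z i * A"
  shows commuting_row: "c < n \<Longrightarrow> c \<noteq> i - 1 \<Longrightarrow> c \<noteq> i \<Longrightarrow> A $$ (i - 1, c) = 0 \<and> A $$ (i, c) = 0"
    and commuting_col: "r < n \<Longrightarrow> r \<noteq> i - 1 \<Longrightarrow> r \<noteq> i \<Longrightarrow> A $$ (r, i - 1) = 0 \<and> A $$ (r, i) = 0"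
    and commuting_block: "A $$ (i - 1, i - 1) = A $$ (i, i)" "A $$ (i - 1, i) = z * A $$ (i, i - 1)"
proof -
  have E: "A $$ (r, sw i c) * swd z 1 i c = swd z 1 i (sw i r) * A $$ (sw i r, c)"
    if "r < n" "c < n" for r c
    using arg_cong[OF comm, of "\<lambda>M. M $$ (r, c)"] A i that
    by (simp add: mult_mono_mat_entry sw_mult_entry sw_less)
  have zero: "x = 0" if "x = z * y" "x = y" for x y :: complex
    using that \<open>z \<noteq> 1\<close> by auto
  note simps = sw_def swd_def mult.commute
  show "A $$ (i - 1, c) = 0 \<and> A $$ (i, c) = 0" if "c < n" "c \<noteq> i - 1" "c \<noteq> i"
    using E[of "i - 1" c] E[of i c] that i zero[of "A $$ (i - 1, c)" "A $$ (i, c)"]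
    by (auto simp: simps split: if_splits)
  show "A $$ (r, i - 1) = 0 \<and> A $$ (r, i) = 0" if "r < n" "r \<noteq> i - 1" "r \<noteq> i"
    using E[of r "i - 1"] E[of r i] that i zero[of "A $$ (r, i)" "A $$ (r, i - 1)"]
    by (auto simp: simps split: if_splits)
  show "A $$ (i - 1, i - 1) = A $$ (i, i)"
    using E[of i "i - 1"] i by (auto simp: simps split: if_splits)
  show "A $$ (i - 1, i) = z * A $$ (i, i - 1)"
    using E[of "i - 1" "i - 1"] i by (auto simp: simps split: if_splits)
qed

text \<open>An off-diagonal entry vanishes as soon as some available generator moves exactly one of its two
  indices. The neighbours \<open>l\<close> and \<open>l + 1\<close> are excluded because only the generator \<open>l + 1\<close>
  may be available when \<open>n = l + 2\<close>, and it moves both.\<close>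

lemma commutant_off_diagonal:
  assumes A: "A \<in> carrier_mat n n" and "z \<noteq> 1" and n: "l + 2 \<le> n"
    and comm: "\<And>i. l < i \<Longrightarrow> i < n \<Longrightarrow> A * braid_mat n z i = braid_mat n z i * A"
    and s: "s < t" "t < n" "l \<le> t" "(s, t) \<noteq> (l, l + 1)"
  shows "A $$ (s, t) = 0 \<and> A $$ (t, s) = 0"
proof -
  have zero: "A $$ (s, t) = 0 \<and> A $$ (t, s) = 0"
    if "l < i" "i < n" "s \<in> {i - 1, i} \<longleftrightarrow> t \<notin> {i - 1, i}" for i
    using commuting_row[OF A _ _ \<open>z \<noteq> 1\<close> comm[OF that(1,2)]]
      commuting_col[OF A _ _ \<open>z \<noteq> 1\<close> comm[OF that(1,2)]] that s
    by auto
  consider "t = l" | "t > l" "s + 1 \<noteq> t" | "s + 1 = t" "l < s"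
    using s by force
  then show ?thesis
  proof cases
    case 1
    \<comment> \<open>The generator \<open>l\<close> is not available here, but the next one also moves the coordinate \<open>l\<close>.\<close>
    then show ?thesis using zero[of "l + 1"] s n by auto
  next
    case 2
    then show ?thesis using zero[of t] s by auto
  next
    case 3
    then show ?thesis using zero[of s] s by auto
  qed
qed

lemma commutant_diagonal:
  assumes A: "A \<in> carrier_mat n n" and "z \<noteq> 1"
    and comm: "\<And>i. l < i \<Longrightarrow> i < n \<Longrightarrow> A * braid_mat n z i = braid_mat n z i * A"
    and "l \<le> t" "t < n"
  shows "A $$ (t, t) = A $$ (l, l)"
  using \<open>l \<le> t\<close> \<open>t < n\<close>
proof (induction t rule: dec_induct)
  case (step t)
  then show ?case using commuting_block(1)[OF A _ _ \<open>z \<noteq> 1\<close> comm, of "Suc t"] by simp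
qed simp

text \<open>Schur's lemma for the standard representation. From three strings on, the second generator
  separates the coordinates 0 and 1, the only pair left open by \<open>commutant_off_diagonal\<close>.\<close>

lemma commutant_scalar:
  assumes Q: "Q \<in> carrier_mat n n" and "z \<noteq> 1" and "3 \<le> n"
    and comm: "\<And>i. 1 \<le> i \<Longrightarrow> i < n \<Longrightarrow> Q * braid_mat n z i = braid_mat n z i * Q"
  shows "Q = Q $$ (0, 0) \<cdot>\<^sub>m 1\<^sub>m n"
proof -
  have comm0: "Q * braid_mat n z i = braid_mat n z i * Q" if "0 < i" "i < n" for i
    using comm that by simp
  have "Q $$ (s, t) = 0 \<and> Q $$ (t, s) = 0" if "s < t" "t < n" for s t
  proof (cases "(s, t) = (0, 1)")
    case True
    then show ?thesis
      using commuting_row[OF Q _ _ \<open>z \<noteq> 1\<close> comm0[of 2], of 0]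
        commuting_col[OF Q _ _ \<open>z \<noteq> 1\<close> comm0[of 2], of 0] \<open>3 \<le> n\<close> by auto
  next
    case False
    then show ?thesis
      using commutant_off_diagonal[OF Q \<open>z \<noteq> 1\<close> _ comm0, of 0 s t] that \<open>3 \<le> n\<close> by auto
  qed
  then have off: "Q $$ (r, c) = 0" if "r < n" "c < n" "r \<noteq> c" for r c
    using that by (metis nat_neq_iff)
  have diag: "Q $$ (r, r) = Q $$ (0, 0)" if "r < n" for r
    using commutant_diagonal[OF Q \<open>z \<noteq> 1\<close> comm0, of 0 r] that by simp
  show ?thesis
  proof (rule eq_matI)
    fix r c assume "r < dim_row (Q $$ (0, 0) \<cdot>\<^sub>m 1\<^sub>m n)" "c < dim_col (Q $$ (0, 0) \<cdot>\<^sub>m 1\<^sub>m n)"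
    then show "Q $$ (r, c) = (Q $$ (0, 0) \<cdot>\<^sub>m 1\<^sub>m n) $$ (r, c)"
      using off[of r c] diag[of r] by (cases "r = c") simp_all
  qed (use Q in auto)
qed

section \<open>The image of the first symmetric generator\<close>

text \<open>The unknowns are entries of \<open>A\<^sub>1\<close>: the upper left block has rows \<open>(a, b)\<close> and
  \<open>(c, d)\<close>, and the block on the coordinates 2 and 3 has rows \<open>(p, z q)\<close> and \<open>(q, p)\<close>.
  The hypotheses come from \<open>A\<^sub>1\<^sup>2 = 1\<close>, \<open>A\<^sub>1 A\<^sub>2 A\<^sub>1 = A\<^sub>2 A\<^sub>1 A\<^sub>2\<close> and
  \<open>A\<^sub>1 A\<^sub>2 S\<^sub>1 = S\<^sub>2 A\<^sub>1 A\<^sub>2\<close>. The solution with \<open>q \<noteq> 0\<close> is excluded because it would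
  need \<open>p = 0\<close>, hence \<open>z q\<^sup>2 = 1\<close>, together with \<open>q\<^sup>2 = 1\<close>.\<close>

lemma block_equations:
  fixes a b c d p q z :: complex
  assumes z: "z \<noteq> 0" "z \<noteq> 1"
    and sq: "a * a + b * c = 1" "a * b + b * d = 0" "c * b + d * d = 1"
      "p * p + q * z * q = 1"
    and braid: "q * q * a = q * q * d"
    and mixed: "p * (q * z) = c * (q * z ^ 3)" "c * (q * z ^ 3) = z * (p * (q * z))"
      "d * a = q * q" "d * b = z * (p * d)" "p * d = d * b"
  shows "q = 0 \<and> p \<in> {-1, 1} \<and> a = 0 \<and> d = 0 \<and> b * c = 1"
proof -
  have q: "q = 0"
  proof (rule ccontr)
    assume "q \<noteq> 0"
    have "(z - 1) * (p * q * z) = 0" using mixed(1,2) by (simp add: algebra_simps)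
    then have "p = 0" using z \<open>q \<noteq> 0\<close> by simp
    then have "c = 0" using mixed(1) z \<open>q \<noteq> 0\<close> by simp
    have "a = d" using braid \<open>q \<noteq> 0\<close> by simp
    then have "q * q = 1" using sq(3) mixed(3) \<open>c = 0\<close> by simp
    then have "z = q * z * q" by (simp add: mult_ac)
    also have "\<dots> = 1" using sq(4) \<open>p = 0\<close> by simp
    finally have "z = 1" .
    then show False using z by simp
  qed
  then have p: "p * p = 1" using sq(4) by simp
  have "p * d = z * (p * d)" using mixed(4,5) by (rule HOL.trans[rotated])
  then have "p * d = 0" using z(2) by (metis mult_cancel_right1)
  then have "d = 0" using p by auto
  then show ?thesis using q p sq by (auto simp: square_eq_1_iff mult.commute)
qed

text \<open>Here \<open>A\<close> and \<open>B\<close> are the images of the first two symmetric generators, with the relations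
  that suffice to determine \<open>A\<close>.\<close>

locale welded_pair =
  fixes n :: nat and z :: complex and A B :: "complex mat"
  assumes n: "4 \<le> n" and z: "z \<noteq> 0" "z \<noteq> 1"
    and A: "A \<in> carrier_mat n n" and B: "B \<in> carrier_mat n n"
    and square: "A * A = 1\<^sub>m n"
    and braid: "A * (B * A) = B * (A * B)"
    and mixed: "A * (B * braid_mat n z 1) = braid_mat n z 2 * (A * B)"
    and conj: "braid_mat n z 1 * (braid_mat n z 2 * A) = B * (braid_mat n z 1 * braid_mat n z 2)"
    and far: "\<And>i. 3 \<le> i \<Longrightarrow> i < n \<Longrightarrow> A * braid_mat n z i = braid_mat n z i * A"
begin

lemma A_off_diagonal:
  assumes "s < t" "t < n" "2 \<le> t" "(s, t) \<noteq> (2, 3)"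
  shows "A $$ (s, t) = 0" "A $$ (t, s) = 0"
  using commutant_off_diagonal[OF A z(2), of 2 s t] far n assms by auto

lemma A_low: 
  assumes "r < 2" "2 \<le> c" "c < n" shows "A $$ (r, c) = 0" "A $$ (c, r) = 0"
  using A_off_diagonal[of r c] assms by auto

lemma A_23: "A $$ (2, 3) = A $$ (3, 2) * z" "A $$ (3, 3) = A $$ (2, 2)"
  using commuting_block[OF A _ _ z(2) far[of 3]] n by (auto simp: mult.commute)

text \<open>\<open>S\<^sub>1 S\<^sub>2\<close> is monomial: it permutes the coordinates 0, 1, 2 cyclically, with the factor
  \<open>z\<^sup>2\<close> in column 2 and the factor 1 elsewhere. So the entries of the conjugate \<open>B\<close> of \<open>A\<close>
  by it are entries of \<open>A\<close> moved along this cycle, up to powers of \<open>z\<close>.\<close>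

lemma B_entries:
  assumes "r < n" "c < n"
  shows "B $$ (sw 1 (sw 2 r), sw 1 (sw 2 c)) * (if c = 2 then z * z else 1)
    = (if r = 2 then z * z else 1) * A $$ (r, c)"
proof -
  define r' where "r' = sw 1 (sw 2 r)"
  have r': "r' < n" "sw 2 (sw 1 r') = r"
    using assms n by (auto simp: r'_def sw_invol sw_less)
  have "(B * (braid_mat n z 1 * braid_mat n z 2)) $$ (r', c)
      = B $$ (r', sw 1 (sw 2 c)) * (swd z 1 1 (sw 2 c) * swd z 1 2 c)"
    using assms n r' B by (simp add: mono_mat_mult mult_mono_mat_entry sw_less)
  moreover have "(braid_mat n z 1 * (braid_mat n z 2 * A)) $$ (r', c)
      = swd z 1 1 (sw 1 r') * (swd z 1 2 r * A $$ (r, c))"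
    using assms n r' A sw_less[of 1 n r'] by (simp add: sw_mult_entry mult_carrier_mat[of _ n n])
  moreover have "sw 1 r' = sw 2 r" by (simp add: r'_def sw_invol)
  ultimately have "B $$ (r', sw 1 (sw 2 c)) * (swd z 1 1 (sw 2 c) * swd z 1 2 c)
      = swd z 1 1 (sw 2 r) * swd z 1 2 r * A $$ (r, c)"
    using conj by (simp only: mult.assoc)
  moreover have "swd z 1 1 (sw 2 x) * swd z 1 2 x = (if x = 2 then z * z else 1)" for x
    by (auto simp: sw_def swd_def)
  ultimately show ?thesis
    by (simp only: r'_def)
qed

lemma B_values:
  shows "B $$ (0, 0) = A $$ (2, 2)" "B $$ (0, 1) = 0" "B $$ (0, 2) = 0"
    "B $$ (0, 3) = A $$ (3, 2) * z ^ 3"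
    "B $$ (1, 0) = 0" "B $$ (1, 1) = A $$ (0, 0)" "B $$ (1, 2) = A $$ (0, 1)" "B $$ (1, 3) = 0"
    "B $$ (2, 0) = 0" "B $$ (2, 1) = A $$ (1, 0)" "B $$ (2, 2) = A $$ (1, 1)" "B $$ (2, 3) = 0"
    "B $$ (3, 0) = A $$ (3, 2) / (z * z)" "B $$ (3, 1) = 0" "B $$ (3, 2) = 0"
    "B $$ (3, 3) = A $$ (2, 2)"
  subgoal using B_entries[of 2 2] n z by (simp add: sw_def)
  subgoal using B_entries[of 2 0] A_low n by (simp add: sw_def)
  subgoal using B_entries[of 2 1] A_low n by (simp add: sw_def)
  subgoal using B_entries[of 2 3] A_23 n by (simp add: sw_def power3_eq_cube)
  subgoal using B_entries[of 0 2] A_low n z by (simp add: sw_def)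
  subgoal using B_entries[of 0 0] n by (simp add: sw_def)
  subgoal using B_entries[of 0 1] n by (simp add: sw_def)
  subgoal using B_entries[of 0 3] A_low n by (simp add: sw_def)
  subgoal using B_entries[of 1 2] A_low n z by (simp add: sw_def)
  subgoal using B_entries[of 1 0] n by (simp add: sw_def)
  subgoal using B_entries[of 1 1] n by (simp add: sw_def)
  subgoal using B_entries[of 1 3] A_low n by (simp add: sw_def)
  subgoal using B_entries[of 3 2] n z by (simp add: sw_def field_simps)
  subgoal using B_entries[of 3 0] A_low n by (simp add: sw_def)
  subgoal using B_entries[of 3 1] A_low n by (simp add: sw_def)
  subgoal using B_entries[of 3 3] A_23 n by (simp add: sw_def)
  done

lemma A_mult_low:
  assumes "X \<in> carrier_mat n n" "r < 2" "c < n"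
  shows "(A * X) $$ (r, c) = A $$ (r, 0) * X $$ (0, c) + A $$ (r, 1) * X $$ (1, c)"
  by (rule mult_entry_two[OF A]) (use assms n A_low in auto)

lemma A_mult_2:
  assumes "X \<in> carrier_mat n n" "c < n"
  shows "(A * X) $$ (2, c) = A $$ (2, 2) * X $$ (2, c) + A $$ (3, 2) * z * X $$ (3, c)"
proof -
  have "A $$ (2, k) = 0" if "k < n" "k \<noteq> 2" "k \<noteq> 3" for k
    using that A_off_diagonal[of k 2] A_off_diagonal[of 2 k] n by (cases k "2::nat" rule: linorder_cases) auto
  then show ?thesis
    using mult_entry_two[OF A assms(1) _ assms(2), of 2 2 3] n A_23 by simp
qed

lemma B_mult_2:
  assumes "X \<in> carrier_mat n n" "c < n"
  shows "(B * X) $$ (2, c) = A $$ (1, 0) * X $$ (1, c) + A $$ (1, 1) * X $$ (2, c)"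
proof -
  have "B $$ (2, k) = 0" if "k < n" "k \<noteq> 1" "k \<noteq> 2" for k
  proof (cases "k = 0")
    case False
    then have "sw 1 (sw 2 k) = k" using that by (auto simp: sw_def)
    then show ?thesis using B_entries[of 1 k] that False A_low[of 1 k] n by (simp add: sw_def)
  qed (simp add: B_values)
  then show ?thesis
    using mult_entry_two[OF B assms(1) _ assms(2), of 2 1 2] n B_values by simp
qed

lemma A_shape:
  "A $$ (3, 2) = 0 \<and> A $$ (2, 2) \<in> {-1, 1} \<and> A $$ (0, 0) = 0 \<and> A $$ (1, 1) = 0
    \<and> A $$ (0, 1) * A $$ (1, 0) = 1"
proof -
  have X: "A * B \<in> carrier_mat n n" "B * A \<in> carrier_mat n n" using A B by auto
  have sq: "(A * A) $$ (r, c) = (if r = c then 1 else 0)" if "r < n" "c < n" for r c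
    unfolding square using that by simp
  have mix: "(A * B) $$ (r, sw 1 c) * swd z 1 1 c = swd z 1 2 (sw 2 r) * (A * B) $$ (sw 2 r, c)"
    if "r < n" "c < n" for r c
    using arg_cong[OF mixed, of "\<lambda>M. M $$ (r, c)"] X A B that n
    by (simp add: mult_mono_mat_entry sw_mult_entry sw_less del: index_mult_mat
        flip: assoc_mult_mat[OF A B mono_mat_carrier])
  have X30: "(B * A) $$ (3, 0) = A $$ (3, 2) / (z * z) * A $$ (0, 0)"
  proof -
    have "B $$ (3, k) = 0" if "k < n" "k \<noteq> 0" "k \<noteq> 3" for k
    proof (cases "k < 3")
      case True
      then have "k = 1 \<or> k = 2" using that by auto
      then show ?thesis using B_values by auto
    next
      case False
      then show ?thesis
        using B_entries[of 3 k] that A_off_diagonal[of 3 k] n by (simp add: sw_def)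
    qed
    then show ?thesis
      using mult_entry_two[OF B A, of 3 0 0 3] n B_values A_low[of 0 3] by simp
  qed
  \<comment> \<open>The simplifier writes the index 1 as \<open>Suc 0\<close>, so the table of entries must do so too.\<close>
  note mult = A_mult_low A_mult_2 B_mult_2 B_values[unfolded One_nat_def] A B X
  have br: "(A * (B * A)) $$ (2, 0) = (B * (A * B)) $$ (2, 0)" using braid by simp
  have "A $$ (3, 2) * A $$ (3, 2) * A $$ (0, 0) = A $$ (3, 2) * A $$ (3, 2) * A $$ (1, 1)"
    using br n z A_low[of 0 2] by (simp add: mult X30 field_simps del: index_mult_mat)
  moreover have "A $$ (0, 0) * A $$ (0, 0) + A $$ (0, 1) * A $$ (1, 0) = 1"
    "A $$ (0, 0) * A $$ (0, 1) + A $$ (0, 1) * A $$ (1, 1) = 0"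
    "A $$ (1, 0) * A $$ (0, 1) + A $$ (1, 1) * A $$ (1, 1) = 1"
    "A $$ (2, 2) * A $$ (2, 2) + A $$ (3, 2) * z * A $$ (3, 2) = 1"
    using sq[of 0 0] sq[of 0 1] sq[of 1 1] sq[of 2 2] n
    by (simp_all add: mult del: index_mult_mat)
  moreover have "A $$ (2, 2) * (A $$ (3, 2) * z) = A $$ (1, 0) * (A $$ (3, 2) * z ^ 3)"
    using mix[of 2 3] n A_23 by (simp add: mult sw_def swd_def mult_ac del: index_mult_mat)
  moreover have "A $$ (1, 0) * (A $$ (3, 2) * z ^ 3) = z * (A $$ (2, 2) * (A $$ (3, 2) * z))"
    using mix[of 1 3] n A_23 by (simp add: mult sw_def swd_def mult_ac del: index_mult_mat)
  moreover have "A $$ (1, 1) * A $$ (0, 0) = A $$ (3, 2) * A $$ (3, 2)"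
    using mix[of 1 0] n z A_23 by (simp add: mult sw_def swd_def mult_ac del: index_mult_mat)
  moreover have "A $$ (1, 1) * A $$ (0, 1) = z * (A $$ (2, 2) * A $$ (1, 1))"
    using mix[of 1 2] n A_23 by (simp add: mult sw_def swd_def mult_ac del: index_mult_mat)
  moreover have "A $$ (2, 2) * A $$ (1, 1) = A $$ (1, 1) * A $$ (0, 1)"
    using mix[of 2 2] n A_23 by (simp add: mult sw_def swd_def mult_ac del: index_mult_mat)
  ultimately show ?thesis by (intro block_equations[OF z]) auto
qed

text \<open>The common factor \<open>k\<close> is read off from a coordinate that \<open>\<alpha>\<^sub>1\<close> should fix. Since
  \<open>k\<^sup>2 = 1\<close>, dividing the entry at \<open>(1, 0)\<close> by \<open>k\<close> is multiplying it by \<open>k\<close>, which gives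
  the parameter \<open>l\<close>.\<close>

lemma A_eq_tau_alpha:
  obtains k l where "k \<in> {-1, 1}" "l \<noteq> 0" "A = k \<cdot>\<^sub>m tau_alpha n l 1"
proof
  define k where "k = A $$ (2, 2)"
  note sh = A_shape
  show k: "k \<in> {-1, 1}" using sh by (simp add: k_def)
  show l: "k * A $$ (1, 0) \<noteq> 0" using sh k by auto
  have b: "A $$ (0, 1) = k / (k * A $$ (1, 0))" using sh l by (simp add: nonzero_eq_divide_eq mult.left_commute)
  have diag: "A $$ (t, t) = k" if "2 \<le> t" "t < n" for t
    using commutant_diagonal[OF A z(2), of 2 t] far that by (simp add: k_def)
  have "A $$ (s, t) = 0 \<and> A $$ (t, s) = 0" if "s < t" "t < n" "2 \<le> t" for s t
    using that A_off_diagonal[of s t] sh A_23 by (cases "(s, t) = (2, 3)") auto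
  then have off: "A $$ (r, c) = 0" if "r < n" "c < n" "r \<noteq> c" "2 \<le> r \<or> 2 \<le> c" for r c
    using that by (metis linorder_neqE_nat order.strict_implies_order order.trans)
  show "A = k \<cdot>\<^sub>m tau_alpha n (k * A $$ (1, 0)) 1"
  proof (rule eq_matI)
    let ?T = "k \<cdot>\<^sub>m tau_alpha n (k * A $$ (1, 0)) 1"
    have T: "?T = k \<cdot>\<^sub>m mono_mat n (sw 1) (swd (1 / (k * A $$ (1, 0))) (k * A $$ (1, 0)) 1)"
      using n by (simp add: tau_alpha_mono)
    fix r c assume "r < dim_row ?T" "c < dim_col ?T"
    then have rc: "r < n" "c < n" unfolding T mono_mat_def by simp_all
    then have T_entry: "?T $$ (r, c) =
        k * (if r = sw 1 c then swd (1 / (k * A $$ (1, 0))) (k * A $$ (1, 0)) 1 c else 0)"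
      unfolding T using rc by (simp add: mono_mat_def)
    consider "r < 2" "c < 2" | "r \<noteq> c" "2 \<le> r \<or> 2 \<le> c" | "r = c" "2 \<le> r" by linarith
    then show "A $$ (r, c) = ?T $$ (r, c)"
    proof cases
      case 1
      then show ?thesis unfolding T_entry using b k sh
        by (auto simp: less_2_cases_iff sw_def swd_def)
    next
      case 2
      then show ?thesis unfolding T_entry using off rc by (auto simp: sw_def swd_def)
    next
      case 3
      then show ?thesis unfolding T_entry using diag rc by (auto simp: sw_def swd_def)
    qed
  qed (use A n in \<open>auto simp: tau_alpha_mono mono_mat_def\<close>)
qed

end

section \<open>Representations of the welded braid group on its generators\<close>

text \<open>The relations are stated for classes of words in the presented group. Evaluating a homomorphism
  on positive words turns them into equations between the images of the generators.\<close>

lemma (in presentation) hom_positive_word: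
  assumes h: "h \<in> hom G H" and H: "group H" and "set xs \<subseteq> S"
  shows "h (cl (map (\<lambda>x. (x, True)) xs)) = word_eval H (\<lambda>x. h (pres_gen S R x)) (map (\<lambda>x. (x, True)) xs)"
  using \<open>set xs \<subseteq> S\<close>
proof (induction xs)
  case Nil
  then show ?case using hom_one[OF h group_G H] by (simp add: one_cl)
next
  case (Cons x xs)
  let ?w = "map (\<lambda>x. (x, True)) xs"
  have w: "?w \<in> gwords S" using Cons.prems by (auto simp: gwords_def)
  have "cl ((x, True) # ?w) = pres_gen S R x \<otimes>\<^bsub>G\<^esub> cl ?w"
    using mult_cl[of "[(x, True)]" ?w] w Cons.prems by (simp add: pres_gen_def)
  then show ?case
    using Cons hom_mult[OF h gen_carrier cl_carrier[OF w], of x] by simp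
qed

lemma hom_WB_relation:
  assumes h: "h \<in> hom (WB n) H" and H: "group H" and uv: "(u, v) \<in> wb_equations n"
  shows "word_eval H (\<lambda>x. h (wb_gen n x)) (map (\<lambda>x. (x, True)) u) =
    word_eval H (\<lambda>x. h (wb_gen n x)) (map (\<lambda>x. (x, True)) v)"
proof -
  let ?m = "map (\<lambda>x. (x, True)) :: wb_letter list \<Rightarrow> wb_letter gword"
  have uv': "(?m u, ?m v) \<in> wb_relations n" using uv by (force simp: wb_relations_def)
  have "set u \<subseteq> wb_letters n" "set v \<subseteq> wb_letters n"
    using uv unfolding wb_equations_def wb_letters_def by auto
  then show ?thesis
    using WB.hom_positive_word[OF h[unfolded WB_def] H, of u] WB.hom_positive_word[OF h[unfolded WB_def] H, of v]
      WB.cl_eq[OF pres_rel.relation[OF uv']] by (simp add: wb_gen_def)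
qed

lemma smult_smult_mat: "a \<cdot>\<^sub>m (b \<cdot>\<^sub>m M) = (a * b :: complex) \<cdot>\<^sub>m M"
  by (rule eq_matI) auto

lemma one_smult_mat: "(1 :: complex) \<cdot>\<^sub>m M = M"
  by (rule eq_matI) auto

lemma GL_carrier_mat: "P \<in> carrier (GL n) \<Longrightarrow> P \<in> carrier_mat n n"
  by (simp add: GL_simps)

lemma equiv_rep_intertwiner:
  assumes "\<rho> \<in> hom G (GL n)" "equiv_rep G n \<rho> \<rho>1" "equiv_rep G n \<rho> \<rho>2"
  obtains Q where "Q \<in> carrier (GL n)" "\<And>g. g \<in> carrier G \<Longrightarrow> Q * \<rho>1 g = \<rho>2 g * Q"
proof -
  interpret GL: group "GL n" by (rule group_GL)
  obtain P1 P2 where P: "P1 \<in> carrier (GL n)" "P2 \<in> carrier (GL n)"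
    and eq: "\<And>g. g \<in> carrier G \<Longrightarrow> \<rho>1 g = P1 \<otimes>\<^bsub>GL n\<^esub> \<rho> g \<otimes>\<^bsub>GL n\<^esub> inv\<^bsub>GL n\<^esub> P1"
      "\<And>g. g \<in> carrier G \<Longrightarrow> \<rho>2 g = P2 \<otimes>\<^bsub>GL n\<^esub> \<rho> g \<otimes>\<^bsub>GL n\<^esub> inv\<^bsub>GL n\<^esub> P2"
    using assms(2,3) unfolding equiv_rep_def GL_simps by blast
  let ?Q = "P2 \<otimes>\<^bsub>GL n\<^esub> inv\<^bsub>GL n\<^esub> P1"
  have "?Q \<otimes>\<^bsub>GL n\<^esub> \<rho>1 g = \<rho>2 g \<otimes>\<^bsub>GL n\<^esub> ?Q" if "g \<in> carrier G" for g
  proof -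
    have R: "\<rho> g \<in> carrier (GL n)" using assms(1) that by (auto simp: hom_def)
    show ?thesis
      unfolding eq[OF that] using P R
      by (simp add: GL.m_assoc GL.inv_solve_left' flip: GL.m_assoc[of "inv\<^bsub>GL n\<^esub> P1" P1]
          GL.m_assoc[of "inv\<^bsub>GL n\<^esub> P2" P2])
  qed
  then show ?thesis using that[of ?Q] P by (simp add: GL_simps(1) GL.m_closed[unfolded GL_simps(1)])
qed

lemma char_tensor_props:
  assumes "z \<noteq> 0" "l \<noteq> 0" "k \<in> {-1, 1}"
  shows char_tensor_hom: "char_tensor (X_rep n 1 k) (tau_tilde n z l) \<in> hom (WB n) (GL n)"
    and char_tensor_Sigma: "i \<in> {1..<n} \<Longrightarrow>
      char_tensor (X_rep n 1 k) (tau_tilde n z l) (wb_gen n (Sigma_gen i)) = braid_mat n z i"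
    and char_tensor_Alpha: "i \<in> {1..<n} \<Longrightarrow>
      char_tensor (X_rep n 1 k) (tau_tilde n z l) (wb_gen n (Alpha_gen i)) = k \<cdot>\<^sub>m tau_alpha n l i"
proof -
  let ?X = "X_rep n 1 k" and ?T = "tau_tilde n z l"
  have X: "?X \<in> hom (WB n) Cstar" by (rule X_rep_hom) (use assms in auto)
  have T: "?T \<in> hom (WB n) (GL n)" using tau_tilde_rep[OF assms(1,2)] by (simp add: is_rep_def)
  show "char_tensor ?X ?T \<in> hom (WB n) (GL n)"
  proof (rule homI)
    fix g assume g: "g \<in> carrier (WB n)"
    have x: "?X g \<noteq> 0" using hom_in_carrier[OF X g] by simp
    have "?T g \<in> carrier (GL n)" using hom_in_carrier[OF T g] .
    then obtain M where M: "?T g \<in> carrier_mat n n" "M \<in> carrier_mat n n" "M * ?T g = 1\<^sub>m n" "?T g * M = 1\<^sub>m n"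
      by (auto simp: GL_simps)
    have "(inverse (?X g) \<cdot>\<^sub>m M) * (?X g \<cdot>\<^sub>m ?T g) = 1\<^sub>m n" "(?X g \<cdot>\<^sub>m ?T g) * (inverse (?X g) \<cdot>\<^sub>m M) = 1\<^sub>m n"
      using M x by (auto simp: mult_smult_distrib[of _ n n _ n] mult_smult_assoc_mat[of _ n n _ n] smult_smult_mat)
    then show "char_tensor ?X ?T g \<in> carrier (GL n)"
      unfolding char_tensor_def GL_simps using M by (auto intro!: bexI[of _ "inverse (?X g) \<cdot>\<^sub>m M"])
  next
    fix g h assume gh: "g \<in> carrier (WB n)" "h \<in> carrier (WB n)"
    have "?T g \<in> carrier_mat n n" "?T h \<in> carrier_mat n n"
      using gh hom_in_carrier[OF T] GL_carrier_mat by auto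
    then show "char_tensor ?X ?T (g \<otimes>\<^bsub>WB n\<^esub> h) = char_tensor ?X ?T g \<otimes>\<^bsub>GL n\<^esub> char_tensor ?X ?T h"
      using hom_mult[OF X gh] hom_mult[OF T gh]
      by (simp add: char_tensor_def GL_simps(1) mult_smult_distrib[of _ n n _ n]
          mult_smult_assoc_mat[of _ n n _ n] smult_smult_mat mult.commute)
  qed
  show "char_tensor ?X ?T (wb_gen n (Sigma_gen i)) = braid_mat n z i" if "i \<in> {1..<n}"
    using that assms by (simp add: char_tensor_def X_rep_Sigma tau_tilde_Sigma tau_sigma_mono one_smult_mat)
  show "char_tensor ?X ?T (wb_gen n (Alpha_gen i)) = k \<cdot>\<^sub>m tau_alpha n l i" if "i \<in> {1..<n}"
    using that assms by (simp add: char_tensor_def X_rep_Alpha tau_tilde_Alpha)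
qed

text \<open>Both families satisfy \<open>S\<^sub>i S\<^sub>i\<^sub>+\<^sub>1 X\<^sub>i = X\<^sub>i\<^sub>+\<^sub>1 S\<^sub>i S\<^sub>i\<^sub>+\<^sub>1\<close>, and \<open>S\<^sub>i S\<^sub>i\<^sub>+\<^sub>1\<close> is
  invertible, so agreement propagates from one index to the next.\<close>

lemma alpha_images:
  fixes k l z :: complex
  assumes "z \<noteq> 0" and C: "\<And>i. 1 \<le> i \<Longrightarrow> i < n \<Longrightarrow> A i \<in> carrier_mat n n"
    and conj: "\<And>i. 1 \<le> i \<Longrightarrow> Suc i < n \<Longrightarrow>
      braid_mat n z i * (braid_mat n z (Suc i) * A i) = A (Suc i) * (braid_mat n z i * braid_mat n z (Suc i))"
    and A1: "A 1 = k \<cdot>\<^sub>m tau_alpha n l 1"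
    and "1 \<le> i" "i < n"
  shows "A i = k \<cdot>\<^sub>m tau_alpha n l i"
  using \<open>1 \<le> i\<close> \<open>i < n\<close>
proof (induction i rule: dec_induct)
  case base
  show ?case by (rule A1)
next
  case (step i)
  interpret GL: group "GL n" by (rule group_GL)
  let ?S = "braid_mat n z i * braid_mat n z (Suc i)"
  let ?a = "tau_alpha n l"
  have S: "?S \<in> carrier (GL n)"
    using GL.m_closed[OF sw_GL[of i n z 1] sw_GL[of "Suc i" n z 1]] step \<open>z \<noteq> 0\<close>
    by (simp add: GL_simps(1))
  then obtain W where W: "W \<in> carrier_mat n n" "?S * W = 1\<^sub>m n" and Sc: "?S \<in> carrier_mat n n"
    by (auto simp: GL_simps)
  have a: "?a i \<in> carrier_mat n n" "?a (Suc i) \<in> carrier_mat n n"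
    using step by (simp_all add: tau_alpha_mono)
  have "A (Suc i) * ?S = braid_mat n z i * (braid_mat n z (Suc i) * (k \<cdot>\<^sub>m ?a i))"
    using conj[of i] step by simp
  also have "\<dots> = k \<cdot>\<^sub>m (braid_mat n z i * (braid_mat n z (Suc i) * ?a i))"
    using a by (simp add: mult_smult_distrib[of _ n n _ n] mult_carrier_mat[of _ n n])
  also have "\<dots> = k \<cdot>\<^sub>m (?a (Suc i) * ?S)"
    using step by (simp add: tau_alpha_mono sw_braid)
  also have "\<dots> = (k \<cdot>\<^sub>m ?a (Suc i)) * ?S"
    using a Sc by (simp add: mult_smult_assoc_mat[of _ n n])
  finally have "A (Suc i) * ?S * W = (k \<cdot>\<^sub>m ?a (Suc i)) * ?S * W" by simp
  then show ?case
    using W Sc a C[of "Suc i"] step by (simp add: assoc_mult_mat[of _ n n _ n _ n])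
qed

text \<open>Existence, after the conjugation that makes the restriction to the braid group equal to the
  standard representation.\<close>

lemma standard_extension:
  assumes n: "n \<ge> 4" and z: "z \<noteq> 0" "z \<noteq> 1"
    and h: "h \<in> hom (WB n) (GL n)"
    and Sig: "\<And>i. i \<in> {1..<n} \<Longrightarrow> h (wb_gen n (Sigma_gen i)) = braid_mat n z i"
  obtains k l where "k \<in> {-1, 1}" "l \<noteq> 0"
    "\<And>g. g \<in> carrier (WB n) \<Longrightarrow> h g = char_tensor (X_rep n 1 k) (tau_tilde n z l) g"
proof -
  define A where "A i = h (wb_gen n (Alpha_gen i))" for i
  have C: "A i \<in> carrier_mat n n" if "1 \<le> i" "i < n" for i
    unfolding A_def using that
    by (intro GL_carrier_mat hom_in_carrier[OF h] wb_gen_carrier) (auto simp: wb_letters_def)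
  note rel = hom_WB_relation[OF h group_GL]
  have square: "A 1 * A 1 = 1\<^sub>m n"
    using rel[of "[Alpha_gen 1, Alpha_gen 1]" "[]"] n C[of 1]
    by (auto simp: wb_equations_def GL_simps(1,2) A_def)
  have braid: "A 1 * (A 2 * A 1) = A 2 * (A 1 * A 2)"
    using rel[of "[Alpha_gen 1, Alpha_gen 2, Alpha_gen 1]" "[Alpha_gen 2, Alpha_gen 1, Alpha_gen 2]"]
      n C[of 1] C[of 2]
    by (auto simp: wb_equations_def GL_simps(1,2) A_def)
  have mixed: "A 1 * (A 2 * braid_mat n z 1) = braid_mat n z 2 * (A 1 * A 2)"
    using rel[of "[Alpha_gen 1, Alpha_gen 2, Sigma_gen 1]" "[Sigma_gen 2, Alpha_gen 1, Alpha_gen 2]"]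
      n C[of 1] C[of 2]
    by (auto simp: wb_equations_def GL_simps(1,2) A_def Sig right_mult_one_mat[OF mono_mat_carrier])
  have conj: "braid_mat n z i * (braid_mat n z (Suc i) * A i) = A (Suc i) * (braid_mat n z i * braid_mat n z (Suc i))"
    if "1 \<le> i" "Suc i < n" for i
    using rel[of "[Sigma_gen i, Sigma_gen (Suc i), Alpha_gen i]" "[Alpha_gen (Suc i), Sigma_gen i, Sigma_gen (Suc i)]"]
      C[of i] C[of "Suc i"] that
    by (auto simp: wb_equations_def GL_simps(1,2) A_def Sig right_mult_one_mat[OF mono_mat_carrier])
  have far: "A 1 * braid_mat n z i = braid_mat n z i * A 1" if "3 \<le> i" "i < n" for i
    using rel[of "[Alpha_gen 1, Sigma_gen i]" "[Sigma_gen i, Alpha_gen 1]"] C[of 1] that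
    by (auto simp: wb_equations_def GL_simps(1,2) A_def Sig right_mult_one_mat[OF mono_mat_carrier])
  interpret pair: welded_pair n z "A 1" "A 2"
    by unfold_locales (use n z C square braid mixed conj[of 1] far in \<open>auto simp: numeral_2_eq_2\<close>)
  obtain k l where kl: "k \<in> {-1, 1}" "l \<noteq> 0" "A 1 = k \<cdot>\<^sub>m tau_alpha n l 1"
    by (rule pair.A_eq_tau_alpha)
  let ?h' = "char_tensor (X_rep n 1 k) (tau_tilde n z l)"
  have Alp: "A i = k \<cdot>\<^sub>m tau_alpha n l i" if "1 \<le> i" "i < n" for i
    by (rule alpha_images[where z = z, OF z(1) C conj kl(3) that])
  have "h (wb_gen n x) = ?h' (wb_gen n x)" if "x \<in> wb_letters n" for x
    using that kl z Alp Sig unfolding A_def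
    by (auto simp: wb_letters_def char_tensor_Sigma char_tensor_Alpha)
  moreover have "wb_gen n ` wb_letters n \<subseteq> carrier (WB n)" using wb_gen_carrier by blast
  ultimately have "h g = ?h' g" if "g \<in> carrier (WB n)" for g
    using hom_eq_on_generate[OF group_WB group_GL, of "wb_gen n" "wb_letters n" n h n ?h' g]
      h char_tensor_hom[OF z(1) kl(2,1), of n] that
    by (simp add: generate_WB)
  then show ?thesis using that kl by blast
qed

text \<open>The intertwiner \<open>Q\<close> is a nonzero scalar, so the images of \<open>\<alpha>\<^sub>1\<close> agree. Its entry at
  \<open>(2, 2)\<close> is \<open>k\<close>, and its entry at \<open>(1, 0)\<close> is \<open>k l\<close>.\<close>

lemma parameters_unique:
  assumes n: "3 \<le> n" and z: "z \<noteq> 0" "z \<noteq> 1"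
    and l: "l \<noteq> 0" "l' \<noteq> 0" and k: "k \<in> {-1, 1}" "k' \<in> {-1, 1}"
    and Q: "Q \<in> carrier (GL n)"
    and tw: "\<And>g. g \<in> carrier (WB n) \<Longrightarrow>
      Q * char_tensor (X_rep n 1 k) (tau_tilde n z l) g =
      char_tensor (X_rep n 1 k') (tau_tilde n z l') g * Q"
  shows "k = k' \<and> l = l'"
proof -
  have Qc: "Q \<in> carrier_mat n n" using Q by (rule GL_carrier_mat)
  have gen: "wb_gen n (Sigma_gen i) \<in> carrier (WB n)" "wb_gen n (Alpha_gen i) \<in> carrier (WB n)"
    if "1 \<le> i" "i < n" for i
    using that by (auto intro!: wb_gen_carrier simp: wb_letters_def)
  have "Q * braid_mat n z i = braid_mat n z i * Q" if "1 \<le> i" "i < n" for i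
    using tw[OF gen(1)[OF that]] that z l k by (simp add: char_tensor_Sigma)
  then have Qs: "Q = Q $$ (0, 0) \<cdot>\<^sub>m 1\<^sub>m n"
    by (intro commutant_scalar[OF Qc z(2) n]) auto
  define q where "q = Q $$ (0, 0)"
  have q: "q \<noteq> 0"
  proof
    assume "q = 0"
    then have "Q = 0\<^sub>m n n" using Qs by (auto simp: q_def)
    then have "1\<^sub>m n = (0\<^sub>m n n :: complex mat)" using Q by (auto simp: GL_simps)
    then have "(1\<^sub>m n :: complex mat) $$ (0, 0) = 0\<^sub>m n n $$ (0, 0)" by simp
    then show False using n by simp
  qed
  let ?a = "\<lambda>l. mono_mat n (sw 1) (swd (1 / l) l 1)"
  have "Q * (k \<cdot>\<^sub>m ?a l) = (k' \<cdot>\<^sub>m ?a l') * Q"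
    using tw[OF gen(2)[of 1]] n z l k by (simp add: char_tensor_Alpha tau_alpha_mono)
  then have "q \<cdot>\<^sub>m (k \<cdot>\<^sub>m ?a l) = q \<cdot>\<^sub>m (k' \<cdot>\<^sub>m ?a l')"
    unfolding Qs[folded q_def]
    by (simp add: mult_smult_assoc_mat[of _ n n _ n] mult_smult_distrib[of _ n n _ n]
        smult_smult_mat mult.commute left_mult_one_mat[OF mono_mat_carrier] right_mult_one_mat[OF mono_mat_carrier])
  then have e: "(q \<cdot>\<^sub>m (k \<cdot>\<^sub>m ?a l)) $$ (r, c) = (q \<cdot>\<^sub>m (k' \<cdot>\<^sub>m ?a l')) $$ (r, c)" for r c
    by simp
  have entry: "k * ?a l $$ (r, c) = k' * ?a l' $$ (r, c)" if "r < n" "c < n" for r c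
    using q that e[of r c] by (simp add: mono_mat_def)
  have "k = k'" using entry[of 2 2] n by (simp add: mono_mat_def sw_def swd_def)
  moreover have "k * l = k' * l'" using entry[of 1 0] n by (simp add: mono_mat_def sw_def swd_def)
  ultimately show ?thesis using k by auto
qed

section \<open>Classification of the extensions\<close>

theorem theorem4p11:
  fixes n :: nat and \<rho> :: "wb_letter gword set \<Rightarrow> complex mat" and z :: complex
  assumes "n \<ge> 4"
    and "is_rep (WB n) n \<rho>"
    and "z \<noteq> 0" and "z \<noteq> 1"
    and "equiv_rep (BG n) n (restrict \<rho> (braid_sub n)) (tau n z)"
  shows "\<exists>!p :: complex \<times> complex. case p of (lam, k) \<Rightarrow>
           lam \<noteq> 0 \<and> k \<in> {-1, 1} \<and>
           equiv_rep (WB n) n \<rho> (char_tensor (X_rep n 1 k) (tau_tilde n z lam))"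
proof -
  interpret GL: group "GL n" by (rule group_GL)
  have rho: "\<rho> \<in> hom (WB n) (GL n)" using assms(2) by (simp add: is_rep_def)
  obtain P where P: "P \<in> carrier (GL n)"
    and tau: "\<And>g. g \<in> braid_sub n \<Longrightarrow> tau n z g = P \<otimes>\<^bsub>GL n\<^esub> \<rho> g \<otimes>\<^bsub>GL n\<^esub> inv\<^bsub>GL n\<^esub> P"
    using assms(5) by (auto simp: equiv_rep_def BG_def GL_simps(1))
  define h where "h g = P \<otimes>\<^bsub>GL n\<^esub> \<rho> g \<otimes>\<^bsub>GL n\<^esub> inv\<^bsub>GL n\<^esub> P" for g
  have h: "h \<in> hom (WB n) (GL n)"
  proof (rule homI)
    fix x assume "x \<in> carrier (WB n)"
    then show "h x \<in> carrier (GL n)" using P hom_in_carrier[OF rho] by (simp add: h_def)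
  next
    fix x y assume xy: "x \<in> carrier (WB n)" "y \<in> carrier (WB n)"
    have [simp]: "\<rho> x \<in> carrier (GL n)" "\<rho> y \<in> carrier (GL n)"
      using xy hom_in_carrier[OF rho] by auto
    have "inv\<^bsub>GL n\<^esub> P \<otimes>\<^bsub>GL n\<^esub> (P \<otimes>\<^bsub>GL n\<^esub> W) = W" if "W \<in> carrier (GL n)" for W
      using P that by (simp flip: GL.m_assoc)
    then show "h (x \<otimes>\<^bsub>WB n\<^esub> y) = h x \<otimes>\<^bsub>GL n\<^esub> h y"
      using P by (simp add: h_def hom_mult[OF rho xy] GL.m_assoc)
  qed
  have Sig: "h (wb_gen n (Sigma_gen i)) = braid_mat n z i" if "i \<in> {1..<n}" for i
  proof -
    have "wb_gen n (Sigma_gen i) \<in> braid_sub n"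
      unfolding braid_sub_def using that by (intro generate.incl) auto
    then show ?thesis
      using tau tau_Sigma[OF assms(3) that] that by (simp add: h_def tau_sigma_mono)
  qed
  obtain k l where kl: "k \<in> {-1, 1}" "l \<noteq> 0"
    and eq: "\<And>g. g \<in> carrier (WB n) \<Longrightarrow> h g = char_tensor (X_rep n 1 k) (tau_tilde n z l) g"
    using standard_extension[OF assms(1,3,4) h Sig] by blast
  have ex: "equiv_rep (WB n) n \<rho> (char_tensor (X_rep n 1 k) (tau_tilde n z l))"
    unfolding equiv_rep_def using P eq by (auto simp: h_def GL_simps(1) intro!: bexI[of _ P])
  have uniq: "k' = k \<and> l' = l"
    if k': "k' \<in> {-1, 1}" and l': "l' \<noteq> 0"
      and eqv: "equiv_rep (WB n) n \<rho> (char_tensor (X_rep n 1 k') (tau_tilde n z l'))" for k' l'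
  proof -
    obtain Q where "Q \<in> carrier (GL n)"
      "\<And>g. g \<in> carrier (WB n) \<Longrightarrow> Q * char_tensor (X_rep n 1 k') (tau_tilde n z l') g =
        char_tensor (X_rep n 1 k) (tau_tilde n z l) g * Q"
      using equiv_rep_intertwiner[OF rho eqv ex] by blast
    moreover have "3 \<le> n" using assms(1) by simp
    ultimately show ?thesis using parameters_unique[OF _ assms(3,4) l' kl(2) k' kl(1)] by blast
  qed
  show ?thesis
  proof (rule ex1I[of _ "(l, k)"])
    show "case (l, k) of (lam, k) \<Rightarrow> lam \<noteq> 0 \<and> k \<in> {-1, 1} \<and>
        equiv_rep (WB n) n \<rho> (char_tensor (X_rep n 1 k) (tau_tilde n z lam))"
      using kl ex by simp
  next
    fix p :: "complex \<times> complex"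
    assume "case p of (lam, k) \<Rightarrow> lam \<noteq> 0 \<and> k \<in> {-1, 1} \<and>
        equiv_rep (WB n) n \<rho> (char_tensor (X_rep n 1 k) (tau_tilde n z lam))"
    then have "snd p = k \<and> fst p = l" unfolding case_prod_beta by (intro uniq) blast+
    then show "p = (l, k)" by (cases p) simp
  qed
qed

end
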